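(* Let $n\ge 2$ and let $K,L$ be compact convex sets in $\mathbb{R}^n$ with $o\in\operatorname{int}K$, $o\in L$, and $L\subset\operatorname{int}K$. Then $$\log\left(\frac{V(K)^{1/n}-V(L)^{1/n}}{V(K)^{1/n}}\right)\ge\int_{S^{n-1}}\log\left(\frac{h_K(u)-h_L(u)}{h_K(u)}\right)d\overline{V}_n(K,u).$$ Equality holds if and only if $K$ and $L$ are dilatates or $L=\{o\}$.
   Context: $V$ is $n$-dimensional volume, $h_K(x)=\sup\{x\cdot y:y\in K\}$ is the support function, and $S(K,\cdot)$ is the surface area measure of $K$ on $S^{n-1}$. $K$ and $L$ are dilatates if $L=tK$ for some $t>0$. The normalized cone measure of $K$ (with $o\in\operatorname{int}K$) is the Borel probability measure on $S^{n-1}$ given by $d\overline{V}_n(K,v)=\frac{h_K(v)}{nV(K)}\,dS(K,v)$. *)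

theory Defs
  imports "HOL-Analysis.Analysis"
begin

definition support_function :: "'a::euclidean_space set \<Rightarrow> 'a \<Rightarrow> real" where
  "support_function K x = (SUP y\<in>K. x \<bullet> y)"

text \<open>For convex bodies the surface area measure is introduced as by Fenchel and Jessen
  (and in Schneider, Convex Bodies: The Brunn-Minkowski Theory, Section 4.2).  For a nonempty
  closed convex set K and a point x outside K, \<^term>\<open>closest_point K x\<close> is the metric projection
  p(K,x), and u(K,x) is the unit vector pointing from p(K,x) to x; it is an outer unit normal
  vector of K at p(K,x).\<close>

definition outward_direction :: "'a::euclidean_space set \<Rightarrow> 'a \<Rightarrow> 'a" where
  "outward_direction K x = (x - closest_point K x) /\<^sub>R dist x (closest_point K x)"

definition local_parallel_set :: "'a::euclidean_space set \<Rightarrow> real \<Rightarrow> 'a set \<Rightarrow> 'a set" where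
  "local_parallel_set K r E =
     {x. 0 < infdist x K \<and> infdist x K \<le> r \<and> outward_direction K x \<in> E}"

text \<open>By the local Steiner formula, the volume of the local parallel set is, for every Borel
  subset E of the unit sphere, a polynomial in r without constant term,
  with coefficients that are finite measures in E.  The surface area measure S(K,E) is the
  coefficient of r, that is, the limit below, which therefore always exists for a convex body K;
  it is the area of the set of boundary points of K having an outer unit normal vector in E.\<close>

definition surface_area_measure :: "'a::euclidean_space set \<Rightarrow> 'a measure" where
  "surface_area_measure K =
     measure_of (sphere 0 1) (sets (restrict_space borel (sphere 0 1)))
       (\<lambda>E. Lim (at_right 0) (\<lambda>r. emeasure lebesgue (local_parallel_set K r E) / ennreal r))"

definition normalized_cone_measure :: "'a::euclidean_space set \<Rightarrow> 'a measure" where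
  "normalized_cone_measure K =
     density (surface_area_measure K)
       (\<lambda>v. ennreal (support_function K v / (real DIM('a) * measure lebesgue K)))"

definition dilatates :: "'a::euclidean_space set \<Rightarrow> 'a set \<Rightarrow> bool" where
  "dilatates K L \<longleftrightarrow> (\<exists>t>0. L = (\<lambda>x. t *\<^sub>R x) ` K)"

end

theory Submission
  imports Defs
begin

text \<open>Put \<open>m = (V(L)/V(K))^(1/n)\<close> and \<open>t(u) = h_L(u)/h_K(u)\<close>.  The tangent line inequality
  \<open>ln (1 - t) \<le> ln (1 - m) - (t - m)/(1 - m)\<close>, integrated against the cone measure, reduces the claim to
  Minkowski's first inequality, which says that the mean of \<open>t\<close> is at least \<open>m\<close>.  Equality forces
  \<open>h_L = m h_K\<close> almost everywhere, and then Minkowski's inequality for the convex hull of \<open>K\<close> and \<open>r L\<close>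
  with \<open>r m \<le> 1\<close> gives \<open>r L \<subseteq> K\<close>, so that the equality case of Brunn-Minkowski is not needed.

  The surface area measure is handled without polytopes or the Steiner formula.  Translation along
  outward directions does not decrease volume, so the volume of the local parallel set divided by \<open>r\<close>
  is monotone in \<open>r\<close>; hence the limit exists and is countably additive.  Comparing \<open>K + e L\<close> with the set
  \<open>0 < d(x) \<le> e h_L(u(x))\<close>, level set by level set of \<open>h_L\<close>, bounds the first variation of volume
  by the integral of \<open>h_L\<close>, and Brunn-Minkowski bounds it from below.\<close>

section \<open>Nonexpansive maps and Lebesgue measure\<close>

text \<open>The definition of \<open>surface_area_measure\<close> guarantees nothing by itself:
  \<open>Lim\<close> is an unspecified value where no limit exists, and \<open>measure_of\<close>
  yields the zero measure unless the set function is countably additive. Both properties have to be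
  proved for arbitrary Borel sets of directions, whose shells need not be convex. Convexity of the
  distance function makes moving outward along normals distance-nondecreasing, so the inverse motion
  is nonexpansive and cannot enlarge volume. The cone measure has mass 1 exactly when the integral
  of \<open>h_K\<close> is \<open>n V(K)\<close>. The lower bound is Minkowski's inequality with
  \<open>L = K\<close>. For the upper bound the obstacle is that shells exist only outside
  \<open>K\<close>; it is obtained in the outer layer of a parallel body, which is then shrunk back
  to \<open>K\<close>. The tangent point \<open>m\<close> is the constant value of \<open>t\<close>
  when \<open>L\<close> is a dilatate of \<open>K\<close>. That \<open>m < 1\<close> follows on the
  way: \<open>m\<close> is at most the mean of \<open>t\<close>, hence at most its maximum over the
  sphere, which is below 1.\<close>

lemma emeasure_UN_countable_le:
  assumes I: "countable I" and X: "\<And>i. i \<in> I \<Longrightarrow> X i \<in> sets M"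
  shows "emeasure M (\<Union>(X ` I)) \<le> (\<integral>\<^sup>+i. emeasure M (X i) \<partial>count_space I)"
proof -
  have "emeasure M (\<Union>(X ` I)) = (\<integral>\<^sup>+x. indicator (\<Union>(X ` I)) x \<partial>M)"
    using I X by (intro nn_integral_indicator[symmetric] sets.countable_UN'') auto
  also have "\<dots> \<le> (\<integral>\<^sup>+x. \<integral>\<^sup>+i. indicator (X i) x \<partial>count_space I \<partial>M)"
  proof (intro nn_integral_mono)
    fix x
    show "indicator (\<Union>(X ` I)) x \<le> (\<integral>\<^sup>+i. (indicator (X i) x :: ennreal) \<partial>count_space I)"
    proof (cases "x \<in> \<Union>(X ` I)")
      case True
      then obtain j where "j \<in> I" "x \<in> X j" by auto
      then show ?thesis
        using nn_integral_ge_point[of j I "\<lambda>i. indicator (X i) x"] by (auto simp: indicator_def)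
    qed auto
  qed
  also have "\<dots> = (\<integral>\<^sup>+i. \<integral>\<^sup>+x. indicator (X i) x \<partial>M \<partial>count_space I)"
    using I X by (intro nn_integral_count_space_nn_integral) auto
  also have "\<dots> = (\<integral>\<^sup>+i. emeasure M (X i) \<partial>count_space I)"
    using X by (intro nn_integral_cong) auto
  finally show ?thesis .
qed

text \<open>By Vitali's theorem almost all of \<open>S\<close> is covered by disjoint balls that are
  centred in \<open>S\<close> and lie in an open set of nearly the same measure. The part of
  \<open>S\<close> in such a ball is mapped into a ball of equal radius, and the uncovered null set
  stays null because \<open>f\<close> is Lipschitz on it.\<close>

lemma emeasure_nonexpansive_image_le:
  fixes f :: "'a::euclidean_space \<Rightarrow> 'a"
  assumes S: "S \<in> sets lebesgue"
    and f: "\<And>x y. x \<in> S \<Longrightarrow> y \<in> S \<Longrightarrow> dist (f x) (f y) \<le> dist x y"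
  shows "emeasure lebesgue (f ` S) \<le> emeasure lebesgue S"
proof (rule ennreal_le_epsilon)
  fix e :: real assume "e > 0"
  obtain U where U: "open U" "S \<subseteq> U" "U - S \<in> lmeasurable" "emeasure lebesgue (U - S) < ennreal e"
    using sets_lebesgue_outer_open[OF S \<open>e > 0\<close>] by blast
  have Us: "U \<in> sets lebesgue" using U(1) by auto
  have "emeasure lebesgue U = emeasure lebesgue S + emeasure lebesgue (U - S)"
    using U S Us by (metis Diff_disjoint Un_Diff_cancel fmeasurableD plus_emeasure sup.absorb2)
  then have Ule: "emeasure lebesgue U \<le> emeasure lebesgue S + ennreal e"
    using U(4) by (simp add: add_left_mono order_less_imp_le)
  define K where "K = {(x, r). x \<in> S \<and> 0 < r \<and> ball x r \<subseteq> U}"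
  have "\<exists>i. i \<in> K \<and> x \<in> ball (fst i) (snd i) \<and> snd i < d" if xd: "x \<in> S" "0 < d" for x d
  proof -
    obtain k where "k > 0" "ball x k \<subseteq> U" using U xd openE[of U x] by blast
    moreover have "ball x (min k (d/2)) \<subseteq> ball x k" by auto
    ultimately have "(x, min k (d/2)) \<in> K" using xd by (auto simp: K_def)
    then show ?thesis using xd \<open>k > 0\<close> by (intro exI[of _ "(x, min k (d/2))"]) auto
  qed
  then obtain C where C: "countable C" "C \<subseteq> K"
     "pairwise (\<lambda>i j. disjnt (ball (fst i) (snd i)) (ball (fst j) (snd j))) C"
     "negligible (S - (\<Union>i \<in> C. ball (fst i) (snd i)))"
    using Vitali_covering_theorem_balls[of S K fst snd] by blast
  define N where "N = S - (\<Union>i \<in> C. ball (fst i) (snd i))"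
  have "negligible (f ` N)"
  proof (rule negligible_locally_Lipschitz_image)
    fix x assume "x \<in> N"
    then show "\<exists>T B. open T \<and> x \<in> T \<and> (\<forall>y\<in>N \<inter> T. norm (f y - f x) \<le> B * norm (y - x))"
      using f by (intro exI[of _ UNIV] exI[of _ 1]) (auto simp: N_def dist_norm)
  qed (use C in \<open>auto simp: N_def\<close>)
  then have fN: "f ` N \<in> null_sets lebesgue" by (simp add: negligible_iff_null_sets)
  have "f ` S \<subseteq> (\<Union>i \<in> C. ball (f (fst i)) (snd i)) \<union> f ` N"
  proof
    fix y assume "y \<in> f ` S"
    then obtain x where x: "x \<in> S" "y = f x" by auto
    show "y \<in> (\<Union>i \<in> C. ball (f (fst i)) (snd i)) \<union> f ` N"
    proof (cases "x \<in> N")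
      case False
      then obtain i where i: "i \<in> C" "x \<in> ball (fst i) (snd i)" using x by (auto simp: N_def)
      then have "fst i \<in> S" using C(2) by (auto simp: K_def)
      then have "dist (f (fst i)) (f x) < snd i"
        using f[of "fst i" x] i x by simp
      then show ?thesis using x i by auto
    qed (use x in auto)
  qed
  then have "emeasure lebesgue (f ` S) \<le> emeasure lebesgue ((\<Union>i \<in> C. ball (f (fst i)) (snd i)) \<union> f ` N)"
    using fN C by (intro emeasure_mono sets.Un sets.countable_UN'') auto
  also have "\<dots> = emeasure lebesgue (\<Union>i \<in> C. ball (f (fst i)) (snd i))"
    using fN C by (intro emeasure_Un_null_set) auto
  also have "\<dots> \<le> (\<integral>\<^sup>+i. emeasure lebesgue (ball (f (fst i)) (snd i)) \<partial>count_space C)"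
    using C by (intro emeasure_UN_countable_le) auto
  \<comment> \<open>The image balls may overlap, so only subadditivity is available for them; the
    original balls are disjoint and their measures add up inside \<open>U\<close>.\<close>
  also have "\<dots> = (\<integral>\<^sup>+i. emeasure lebesgue (ball (fst i) (snd i)) \<partial>count_space C)"
    using C(2) by (intro nn_integral_cong) (auto simp: K_def emeasure_ball)
  also have "\<dots> = emeasure lebesgue (\<Union>i \<in> C. ball (fst i) (snd i))"
    using C by (intro emeasure_UN_countable[symmetric]) (auto simp: disjoint_family_on_def pairwise_def disjnt_def)
  also have "\<dots> \<le> emeasure lebesgue U"
    using C(2) Us by (intro emeasure_mono) (force simp: K_def)+
  finally show "emeasure lebesgue (f ` S) \<le> emeasure lebesgue S + ennreal e"
    using Ule by order
qed

section \<open>The distance function of a convex set\<close>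

context
  fixes K :: "'a::euclidean_space set"
  assumes K: "closed K" "convex K" "K \<noteq> {}"
begin

lemma infdist_eq_dist_closest_point: "infdist x K = dist x (closest_point K x)"
proof (rule antisym)
  show "infdist x K \<le> dist x (closest_point K x)"
    using K by (intro infdist_le closest_point_in_set)
  obtain q where "q \<in> K" "infdist x K = dist x q" using infdist_attains_inf[of K x] K by auto
  then show "dist x (closest_point K x) \<le> infdist x K" using K closest_point_le by metis
qed

lemma infdist_pos_iff: "0 < infdist x K \<longleftrightarrow> x \<notin> K"
  using in_closed_iff_infdist_zero[OF K(1,3), of x] infdist_nonneg[of x K] by linarith

lemma minus_closest_point:
  "x - closest_point K x = infdist x K *\<^sub>R outward_direction K x"
  by (cases "x = closest_point K x") (auto simp: outward_direction_def infdist_eq_dist_closest_point)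

lemma norm_outward_direction: "x \<notin> K \<Longrightarrow> norm (outward_direction K x) = 1"
  using infdist_pos_iff[of x]
  by (simp add: outward_direction_def infdist_eq_dist_closest_point dist_norm)

lemma outward_direction_inner_le:
  assumes "y \<in> K"
  shows "outward_direction K x \<bullet> y \<le> outward_direction K x \<bullet> closest_point K x"
proof -
  have "outward_direction K x \<bullet> (y - closest_point K x) \<le> 0"
    using closest_point_dot[OF K(2,1) assms, of x]
    by (simp add: outward_direction_def mult_nonneg_nonpos)
  then show ?thesis by (simp add: inner_diff_right)
qed

lemma support_function_outward_direction:
  "support_function K (outward_direction K x) = outward_direction K x \<bullet> closest_point K x"
  unfolding support_function_def
  by (rule cSup_eq_maximum) (use closest_point_in_set[OF K(1,3), of x] outward_direction_inner_le in auto)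

lemma inner_outward_direction:
  assumes "x \<notin> K"
  shows "outward_direction K x \<bullet> x = support_function K (outward_direction K x) + infdist x K"
proof -
  have "outward_direction K x \<bullet> (x - closest_point K x) = infdist x K"
    using norm_outward_direction[OF assms] by (simp add: minus_closest_point dot_square_norm)
  then show ?thesis by (simp add: support_function_outward_direction inner_diff_right)
qed

text \<open>The distance to \<open>K\<close> dominates the signed distance to any halfspace
  containing \<open>K\<close>; here the halfspace supports \<open>K\<close> at the projection of
  \<open>x\<close>.\<close>

lemma infdist_ge_support_gap:
  assumes "x \<notin> K"
  shows "outward_direction K x \<bullet> y - support_function K (outward_direction K x) \<le> infdist y K"
proof -
  let ?u = "outward_direction K x"
  have "?u \<bullet> y - ?u \<bullet> closest_point K y \<le> infdist y K"
    using norm_cauchy_schwarz[of ?u "y - closest_point K y"] norm_outward_direction[OF assms]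
    by (simp add: infdist_eq_dist_closest_point dist_norm inner_diff_right)
  moreover have "?u \<bullet> closest_point K y \<le> support_function K ?u"
    using outward_direction_inner_le[OF closest_point_in_set[OF K(1,3)]]
    by (simp add: support_function_outward_direction)
  ultimately show ?thesis by linarith
qed

text \<open>At \<open>y = x\<close> the bound by the supporting halfspace is attained, so the
  outward direction is a subgradient of the distance function.\<close>

lemma infdist_subgradient:
  assumes "x \<notin> K"
  shows "infdist x K + outward_direction K x \<bullet> (y - x) \<le> infdist y K"
  using infdist_ge_support_gap[OF assms, of y] inner_outward_direction[OF assms]
  by (simp add: inner_diff_right)

text \<open>All of \<open>K\<close> lies behind the supporting hyperplane at the projection, and
  this hyperplane has distance \<open>s\<close> from the new point.\<close>

lemma closest_point_along_normal:
  assumes "x \<notin> K" "0 \<le> s"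
  shows "closest_point K (closest_point K x + s *\<^sub>R outward_direction K x) = closest_point K x"
proof (rule closest_point_unique[symmetric])
  let ?u = "outward_direction K x" and ?p = "closest_point K x"
  show "\<forall>z\<in>K. dist (?p + s *\<^sub>R ?u) ?p \<le> dist (?p + s *\<^sub>R ?u) z"
  proof
    fix z assume z: "z \<in> K"
    have "s \<le> ?u \<bullet> (?p + s *\<^sub>R ?u - z)"
      using outward_direction_inner_le[OF z, of x] norm_outward_direction[OF assms(1)]
      by (simp add: inner_diff_right inner_add_right dot_square_norm)
    also have "\<dots> \<le> norm (?p + s *\<^sub>R ?u - z)"
      using norm_cauchy_schwarz[of ?u "?p + s *\<^sub>R ?u - z"] norm_outward_direction[OF assms(1)]
      by simp
    finally show "dist (?p + s *\<^sub>R ?u) ?p \<le> dist (?p + s *\<^sub>R ?u) z"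
      using norm_outward_direction[OF assms(1)] assms(2) by (simp add: dist_norm)
  qed
qed (use K closest_point_in_set in auto)

lemma
  assumes "x \<notin> K" "- infdist x K < t"
  shows infdist_along_normal: "infdist (x + t *\<^sub>R outward_direction K x) K = infdist x K + t"
    and outward_direction_along_normal:
      "outward_direction K (x + t *\<^sub>R outward_direction K x) = outward_direction K x"
proof -
  let ?u = "outward_direction K x" and ?p = "closest_point K x"
  have x: "x + t *\<^sub>R ?u = ?p + (infdist x K + t) *\<^sub>R ?u"
    using minus_closest_point[of x] by (simp add: algebra_simps)
  then have p: "closest_point K (x + t *\<^sub>R ?u) = ?p"
    using closest_point_along_normal[of x "infdist x K + t"] assms by simp
  show *: "infdist (x + t *\<^sub>R ?u) K = infdist x K + t"
    using norm_outward_direction[OF assms(1)] assms(2)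
    by (simp only: infdist_eq_dist_closest_point[of "x + t *\<^sub>R ?u"] p)
       (simp add: x dist_norm)
  have "x + t *\<^sub>R ?u - ?p = (infdist x K + t) *\<^sub>R ?u"
    using x by simp
  moreover have "x + t *\<^sub>R ?u - ?p = (infdist x K + t) *\<^sub>R outward_direction K (x + t *\<^sub>R ?u)"
    using minus_closest_point[of "x + t *\<^sub>R ?u"] by (simp only: p *)
  ultimately show "outward_direction K (x + t *\<^sub>R ?u) = ?u"
    using assms(2) by simp
qed

text \<open>Sum of the subgradient inequalities at \<open>x\<close> and at \<open>y\<close>.\<close>

lemma outward_direction_monotone:
  assumes "x \<notin> K" "y \<notin> K"
  shows "0 \<le> (x - y) \<bullet> (outward_direction K x - outward_direction K y)"
  using infdist_subgradient[OF assms(1), of y] infdist_subgradient[OF assms(2), of x]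
  by (simp add: inner_diff_right inner_diff_left inner_commute)

text \<open>In the expanded square of the right-hand side the cross term is nonnegative by
  monotonicity, and the other new term is a square.\<close>

lemma dist_le_along_normals:
  assumes "x \<notin> K" "y \<notin> K" "0 \<le> t"
  shows "dist x y \<le> dist (x + t *\<^sub>R outward_direction K x) (y + t *\<^sub>R outward_direction K y)"
proof -
  define w where "w = outward_direction K x - outward_direction K y"
  have "(norm (x - y))\<^sup>2 \<le> (norm ((x - y) + t *\<^sub>R w))\<^sup>2"
    using outward_direction_monotone[OF assms(1,2)] assms(3)
    unfolding w_def[symmetric] power2_norm_eq_inner
    by (simp add: inner_add_left inner_add_right inner_commute)
  then have "norm (x - y) \<le> norm ((x - y) + t *\<^sub>R w)" by simp
  then show ?thesis by (simp add: dist_norm w_def algebra_simps)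
qed

lemma continuous_on_outward_direction: "continuous_on (- K) (outward_direction K)"
  unfolding outward_direction_def
  by (intro continuous_intros continuous_on_closest_point K)
     (auto simp flip: infdist_eq_dist_closest_point simp: in_closed_iff_infdist_zero[OF K(1,3)])

end

text \<open>Half open in the distance, so that adjacent shells are disjoint and volumes of nested
  shells subtract; \<open>a = 0\<close> gives the local parallel set.\<close>

definition shell :: "'a::euclidean_space set \<Rightarrow> 'a set \<Rightarrow> real \<Rightarrow> real \<Rightarrow> 'a set" where
  "shell K E a b = {x. a < infdist x K \<and> infdist x K \<le> b \<and> outward_direction K x \<in> E}"

lemma local_parallel_set_eq_shell: "local_parallel_set K r E = shell K E 0 r"
  by (simp add: local_parallel_set_def shell_def)

context
  fixes K :: "'a::euclidean_space set"
  assumes K: "compact K" "convex K" "K \<noteq> {}"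
begin

text \<open>Continuity of \<open>outward_direction\<close> is available off \<open>K\<close>, and
  \<open>0 \<le> a\<close> keeps the shell there.\<close>

lemma shell_borel:
  assumes E: "E \<in> sets borel" and "0 \<le> a"
  shows "shell K E a b \<in> sets borel"
proof -
  have cl: "closed K" using K compact_imp_closed by blast
  have "outward_direction K \<in> borel_measurable (restrict_space borel (- K))"
    using continuous_on_outward_direction[OF cl K(2,3)] by (rule borel_measurable_continuous_on_restrict)
  from measurable_sets[OF this E] have "outward_direction K -` E \<inter> (- K) \<in> sets (restrict_space borel (- K))"
    by (simp add: space_restrict_space)
  then have "outward_direction K -` E \<inter> (- K) \<in> sets borel"
    using cl by (subst (asm) sets_restrict_space_iff) (auto intro: borel_open)
  moreover have "{x. a < infdist x K} \<inter> {x. infdist x K \<le> b} \<in> sets borel"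
    by (intro sets.Int borel_open borel_closed open_Collect_less closed_Collect_le continuous_intros)
  moreover have "shell K E a b = (outward_direction K -` E \<inter> (- K)) \<inter> ({x. a < infdist x K} \<inter> {x. infdist x K \<le> b})"
    using infdist_pos_iff[OF cl K(2,3)] assms(2) by (fastforce simp: shell_def)
  ultimately show ?thesis by auto
qed

lemma bounded_infdist_le: "bounded {x. infdist x K \<le> r}"
proof -
  obtain B where B: "\<And>y. y \<in> K \<Longrightarrow> norm y \<le> B"
    using K(1) compact_imp_bounded bounded_iff by metis
  have "norm x \<le> B + r" if "infdist x K \<le> r" for x
  proof -
    obtain q where "q \<in> K" "infdist x K = dist x q"
      using infdist_attains_inf[of K x] K compact_imp_closed by auto
    then show ?thesis using B[of q] that norm_triangle_sub[of x q] by (simp add: dist_norm)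
  qed
  then show ?thesis by (auto simp: bounded_iff)
qed

lemma shell_lmeasurable:
  assumes "E \<in> sets borel" and "0 \<le> a"
  shows "shell K E a b \<in> lmeasurable"
  using shell_borel[OF assms, of b] bounded_subset[OF bounded_infdist_le[of b], of "shell K E a b"]
  by (intro bounded_set_imp_lmeasurable) (auto simp: shell_def)

text \<open>The distance function is convex, so its gradient field, the outward direction, is monotone
  and translation of the points outside \<open>K\<close> along it does not decrease distances.\<close>

lemma measure_shell_shift:
  assumes E: "E \<in> sets borel" and a: "0 \<le> a" and t: "0 \<le> t"
  shows "measure lebesgue (shell K E a b) \<le> measure lebesgue (shell K E (a + t) (b + t))"
proof -
  have cl: "closed K" using K compact_imp_closed by blast
  let ?u = "outward_direction K"
  \<comment> \<open>The volume bound concerns images under nonexpansive maps, so the translation is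
    run backwards. The direction is constant along normals, hence \<open>?f\<close> undoes
    it.\<close>
  let ?f = "\<lambda>y. y - t *\<^sub>R ?u y"
  have inv: "\<exists>x. x \<notin> K \<and> y = x + t *\<^sub>R ?u x \<and> ?f y = x" if "a + t < infdist y K" for y
  proof (intro exI conjI)
    have y: "y \<notin> K" "- infdist y K < - t" using that a t infdist_pos_iff[OF cl K(2,3), of y] by auto
    have "infdist (?f y) K = infdist y K - t"
      using infdist_along_normal[OF cl K(2,3) y] by simp
    then show "?f y \<notin> K" using that a infdist_pos_iff[OF cl K(2,3), of "?f y"] by simp
    show "y = ?f y + t *\<^sub>R ?u (?f y)"
      using outward_direction_along_normal[OF cl K(2,3) y] by simp
  qed simp
  have img: "?f ` shell K E (a + t) (b + t) = shell K E a b"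
  proof (intro equalityI subsetI)
    fix x assume "x \<in> ?f ` shell K E (a + t) (b + t)"
    then obtain y where y: "y \<in> shell K E (a + t) (b + t)" "x = ?f y" by auto
    have *: "y \<notin> K" "- infdist y K < - t"
      using y a t infdist_pos_iff[OF cl K(2,3), of y] by (auto simp: shell_def)
    show "x \<in> shell K E a b"
      using infdist_along_normal[OF cl K(2,3) *] outward_direction_along_normal[OF cl K(2,3) *] y
      by (simp add: shell_def)
  next
    fix x assume x: "x \<in> shell K E a b"
    have *: "x \<notin> K" "- infdist x K < t"
      using x a t infdist_pos_iff[OF cl K(2,3), of x] by (auto simp: shell_def)
    show "x \<in> ?f ` shell K E (a + t) (b + t)"
      using infdist_along_normal[OF cl K(2,3) *] outward_direction_along_normal[OF cl K(2,3) *] x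
      by (intro image_eqI[of _ _ "x + t *\<^sub>R ?u x"]) (simp_all add: shell_def)
  qed
  have "emeasure lebesgue (?f ` shell K E (a + t) (b + t)) \<le> emeasure lebesgue (shell K E (a + t) (b + t))"
  proof (rule emeasure_nonexpansive_image_le)
    show "shell K E (a + t) (b + t) \<in> sets lebesgue"
      using shell_lmeasurable[OF E] a t by (auto intro: fmeasurableD)
    fix x y assume xy: "x \<in> shell K E (a + t) (b + t)" "y \<in> shell K E (a + t) (b + t)"
    obtain x' where x': "x' \<notin> K" "x = x' + t *\<^sub>R ?u x'" "?f x = x'" using inv[of x] xy by (auto simp: shell_def)
    obtain y' where y': "y' \<notin> K" "y = y' + t *\<^sub>R ?u y'" "?f y = y'" using inv[of y] xy by (auto simp: shell_def)
    show "dist (?f x) (?f y) \<le> dist x y"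
      using dist_le_along_normals[OF cl K(2,3) x'(1) y'(1) t] unfolding x'(3) y'(3)
      unfolding x'(2)[symmetric] y'(2)[symmetric] .
  qed
  then show ?thesis
    unfolding img using shell_lmeasurable[OF E] a t
    by (simp add: emeasure_eq_measure2)
qed

end

section \<open>Existence of the surface area measure\<close>

lemma tendsto_INF_at_right_0:
  fixes G :: "real \<Rightarrow> 'b :: {complete_linorder, linorder_topology}"
  assumes G: "\<And>s r. 0 < s \<Longrightarrow> s \<le> r \<Longrightarrow> G s \<le> G r"
  shows "(G \<longlongrightarrow> (INF r\<in>{0<..}. G r)) (at_right 0)"
proof (rule order_tendstoI)
  fix a assume "a < (INF r\<in>{0<..}. G r)"
  then have "a < G r" if "0 < r" for r
    using that by (meson INF_lower greaterThan_iff less_le_trans)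
  then show "\<forall>\<^sub>F r in at_right 0. a < G r"
    by (simp add: eventually_at_right_less eventually_mono[OF eventually_at_right_less])
next
  fix a assume "(INF r\<in>{0<..}. G r) < a"
  then obtain s where s: "0 < s" "G s < a" by (auto simp: INF_less_iff)
  then show "\<forall>\<^sub>F r in at_right 0. G r < a"
    unfolding eventually_at_right_field
    by (intro exI[of _ s]) (auto intro!: le_less_trans[of _ "G s"] G)
qed

text \<open>Monotone convergence works along sequences, while the limit is over real radii; by
  monotonicity the radii \<open>1 / Suc k\<close> suffice.\<close>

lemma INF_greaterThan_0_eq_INF_nat:
  fixes G :: "real \<Rightarrow> 'b :: complete_lattice"
  assumes G: "\<And>s r. 0 < s \<Longrightarrow> s \<le> r \<Longrightarrow> G s \<le> G r"
  shows "(INF r\<in>{0<..}. G r) = (INF k. G (1 / Suc k))"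
proof (rule antisym)
  show "(INF r\<in>{0<..}. G r) \<le> (INF k. G (1 / Suc k))"
    by (intro INF_greatest INF_lower) simp
  show "(INF k. G (1 / Suc k)) \<le> (INF r\<in>{0<..}. G r)"
  proof (intro INF_greatest)
    fix r :: real assume r: "r \<in> {0<..}"
    then obtain k where "1 / Suc k < r" using nat_approx_posE[of r] by auto
    then show "(INF k. G (1 / Suc k)) \<le> G r"
      using G[of "1 / Suc k" r] by (intro INF_lower2[of k]) auto
  qed
qed

text \<open>Growing increments are a form of convexity, and a convex function vanishing at 0 has
  increasing slopes from 0. Monotonicity of \<open>F\<close> carries the inequality from grid points
  to real arguments.\<close>

lemma ratio_mono_if_increments_mono:
  fixes F :: "real \<Rightarrow> real"
  assumes mono: "\<And>a b. 0 \<le> a \<Longrightarrow> a \<le> b \<Longrightarrow> F a \<le> F b" and F0: "F 0 = 0"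
    and incr: "\<And>a b t. 0 \<le> a \<Longrightarrow> a \<le> b \<Longrightarrow> 0 \<le> t \<Longrightarrow> F b - F a \<le> F (b + t) - F (a + t)"
    and s: "0 < s" "s \<le> r"
  shows "F s / s \<le> F r / r"
proof -
  \<comment> \<open>On a grid of mesh \<open>h\<close> each of the first \<open>j\<close> increments
    is at most the increment at \<open>k\<close>, so \<open>F (j * h)\<close> is at most
    \<open>j\<close> times that increment.\<close>
  have steps: "real k * F (real j * h) \<le> real j * F (real k * h)" if "0 \<le> h" "j \<le> k" for h j k
    using that(2)
  proof (induction k rule: dec_induct)
    case (step k)
    define c where "c i = F (real (Suc i) * h) - F (real i * h)" for i
    have c: "c i \<le> c k" if "i < j" for i
      using incr[of "real i * h" "real (Suc i) * h" "real (k - i) * h"] \<open>0 \<le> h\<close> that step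
        mult_left_mono[of "real i" "real k" h]
      by (simp add: c_def mult_right_mono of_nat_diff algebra_simps)
    have "F (real j * h) = (\<Sum>i<j. c i)"
      unfolding c_def by (subst sum_lessThan_telescope) (simp add: F0)
    also have "\<dots> \<le> real j * c k"
      using sum_bounded_above[of "{..<j}" c "c k"] c by simp
    finally have "F (real j * h) \<le> real j * c k" .
    then have "real (Suc k) * F (real j * h) \<le> real j * F (real k * h) + real j * c k"
      using step.IH by (simp add: distrib_right)
    also have "\<dots> = real j * F (real (Suc k) * h)"
      by (simp add: c_def algebra_simps)
    finally show ?case .
  qed simp
  have Fr: "0 \<le> F r" using mono[of 0 r] F0 s by simp
  have "F s \<le> (s / r + 1 / real (Suc n)) * F r" for n
  proof -
    define N where "N = real (Suc n)"
    \<comment> \<open>Rounding \<open>s / r\<close> up to a multiple of \<open>1 / N\<close> keeps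
      \<open>s\<close> below the grid point, as monotonicity requires; the price is the error term
      \<open>1 / N\<close>.\<close>
    define j where "j = nat \<lceil>N * s / r\<rceil>"
    have N: "N > 0" by (simp add: N_def)
    have pos: "0 \<le> N * s / r" using s N by simp
    have j: "N * s / r \<le> real j" "real j \<le> N * s / r + 1"
      unfolding j_def using pos by linarith+
    have "N * s / r \<le> N" using s N by (simp add: field_simps)
    then have "j \<le> Suc n"
      unfolding j_def N_def by (metis ceiling_mono ceiling_of_nat nat_int nat_mono)
    have "s \<le> real j * (r / N)" using j(1) s N by (simp add: field_simps)
    then have "F s \<le> F (real j * (r / N))" using s by (intro mono) auto
    also have "N * \<dots> \<le> real j * F (N * (r / N))"
      using steps[of "r / N" j "Suc n"] \<open>j \<le> Suc n\<close> s N by (simp add: N_def)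
    finally have "N * F s \<le> real j * F r" using N by simp
    also have "\<dots> \<le> (N * s / r + 1) * F r" using j(2) Fr by (intro mult_right_mono)
    also have "\<dots> = N * ((s / r + 1 / N) * F r)" using N by (simp add: field_simps)
    finally show ?thesis using N by (simp only: N_def[symmetric] mult_le_cancel_left_pos)
  qed
  moreover have "(\<lambda>n. (s / r + 1 / real (Suc n)) * F r) \<longlonglongrightarrow> (s / r + 0) * F r"
    by (intro tendsto_intros LIMSEQ_Suc lim_1_over_n)
  ultimately have "F s \<le> (s / r + 0) * F r"
    by (intro LIMSEQ_le_const) auto
  then show ?thesis using s by (simp add: field_simps)
qed

context
  fixes K :: "'a::euclidean_space set"
  assumes K: "compact K" "convex K" "K \<noteq> {}"
begin

lemma measure_shell_diff:
  assumes "E \<in> sets borel" "0 \<le> a" "a \<le> b"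
  shows "measure lebesgue (shell K E a b) = measure lebesgue (shell K E 0 b) - measure lebesgue (shell K E 0 a)"
proof -
  have "shell K E a b = shell K E 0 b - shell K E 0 a" using assms by (auto simp: shell_def)
  moreover have "shell K E 0 a \<subseteq> shell K E 0 b" using assms by (auto simp: shell_def)
  ultimately show ?thesis
    using shell_lmeasurable[OF K assms(1)] by (simp add: measurable_measure_Diff fmeasurableD)
qed

lemma measure_shell_ratio_mono:
  assumes E: "E \<in> sets borel" and "0 < s" "s \<le> r"
  shows "measure lebesgue (shell K E 0 s) / s \<le> measure lebesgue (shell K E 0 r) / r"
proof (rule ratio_mono_if_increments_mono[where F = "\<lambda>r. measure lebesgue (shell K E 0 r)"])
  fix a b :: real assume ab: "0 \<le> a" "a \<le> b"
  show "measure lebesgue (shell K E 0 a) \<le> measure lebesgue (shell K E 0 b)"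
    using ab measure_shell_diff[OF E ab] measure_nonneg[of lebesgue "shell K E a b"] by linarith
  fix t :: real assume t: "0 \<le> t"
  show "measure lebesgue (shell K E 0 b) - measure lebesgue (shell K E 0 a)
     \<le> measure lebesgue (shell K E 0 (b + t)) - measure lebesgue (shell K E 0 (a + t))"
    using measure_shell_shift[OF K E ab(1) t, of b] ab t
    by (simp add: measure_shell_diff[OF E, of a b] measure_shell_diff[OF E, of "a + t" "b + t"])
next
  have "shell K E 0 0 = {}" by (auto simp: shell_def)
  then show "measure lebesgue (shell K E 0 0) = 0" by simp
qed (use assms in \<open>auto simp: shell_def\<close>)

lemma emeasure_local_parallel_set_ratio:
  assumes "E \<in> sets borel" "0 < r"
  shows "emeasure lebesgue (local_parallel_set K r E) / ennreal r
    = ennreal (measure lebesgue (shell K E 0 r) / r)"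
  using shell_lmeasurable[OF K assms(1)] assms
  by (simp add: local_parallel_set_eq_shell emeasure_eq_measure2 divide_ennreal)

lemma emeasure_local_parallel_set_ratio_mono:
  assumes "E \<in> sets borel" "0 < s" "s \<le> r"
  shows "emeasure lebesgue (local_parallel_set K s E) / ennreal s
    \<le> emeasure lebesgue (local_parallel_set K r E) / ennreal r"
  using measure_shell_ratio_mono[OF assms] assms
  by (simp add: emeasure_local_parallel_set_ratio ennreal_leI)

text \<open>For fixed \<open>r\<close> the ratio is countably additive in \<open>E\<close>. It
  decreases with \<open>r\<close>, so the limit is an infimum and passes through the countable sum
  by monotone convergence.\<close>

lemma emeasure_surface_area_measure:
  assumes "E \<in> sets (restrict_space borel (sphere 0 1))"
  shows "emeasure (surface_area_measure K) E
    = (INF r\<in>{0<..}. emeasure lebesgue (local_parallel_set K r E) / ennreal r)" (is ?eq)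
    and "emeasure (surface_area_measure K) E
    = Lim (at_right 0) (\<lambda>r. emeasure lebesgue (local_parallel_set K r E) / ennreal r)"
proof -
  let ?M = "sets (restrict_space borel (sphere 0 1)) :: 'a set set"
  let ?G = "\<lambda>E r. emeasure lebesgue (local_parallel_set K r E) / ennreal r"
  let ?S = "\<lambda>E. Lim (at_right 0) (?G E)"
  have bor: "A \<in> sets borel" if "A \<in> ?M" for A
    using that by (subst (asm) sets_restrict_space_iff) auto
  have S: "?S A = (INF r\<in>{0<..}. ?G A r)" if "A \<in> ?M" for A
    using emeasure_local_parallel_set_ratio_mono[OF bor[OF that]]
    by (intro tendsto_Lim tendsto_INF_at_right_0) auto
  have S_nat: "?S A = (INF k. ?G A (1 / Suc k))" if "A \<in> ?M" for A
    unfolding S[OF that] using emeasure_local_parallel_set_ratio_mono[OF bor[OF that]]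
    by (intro INF_greaterThan_0_eq_INF_nat) auto
  have pos: "positive ?M ?S"
    unfolding positive_def using S_nat[of "{}"] by (simp add: local_parallel_set_def)
  have add: "countably_additive ?M ?S"
    unfolding countably_additive_def
  proof (intro allI impI)
    fix A :: "nat \<Rightarrow> 'a set"
    assume A: "range A \<subseteq> ?M" "disjoint_family A" "\<Union>(range A) \<in> ?M"
    have Ai: "A i \<in> ?M" for i using A by auto
    have "?G (\<Union>(range A)) r = (\<Sum>i. ?G (A i) r)" for r
    proof -
      have "local_parallel_set K r (\<Union>(range A)) = (\<Union>i. local_parallel_set K r (A i))"
        by (auto simp: local_parallel_set_def)
      moreover have "disjoint_family (\<lambda>i. local_parallel_set K r (A i))"
        using A(2) by (fastforce simp: local_parallel_set_def disjoint_family_on_def)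
      ultimately have "emeasure lebesgue (local_parallel_set K r (\<Union>(range A)))
          = (\<Sum>i. emeasure lebesgue (local_parallel_set K r (A i)))"
        using shell_lmeasurable[OF K bor[OF Ai]]
        by (subst suminf_emeasure) (auto simp: local_parallel_set_eq_shell)
      then show ?thesis by (simp add: divide_ennreal_def ennreal_suminf_multc)
    qed
    note Gsum = this
    have "?S (\<Union>(range A)) = (INF k. \<Sum>i. ?G (A i) (1 / Suc k))"
      unfolding S_nat[OF A(3)] by (simp only: Gsum)
    also have "\<dots> = (INF k. \<integral>\<^sup>+i. ?G (A i) (1 / Suc k) \<partial>count_space UNIV)"
      by (simp add: nn_integral_count_space_nat)
    also have "\<dots> = (\<integral>\<^sup>+i. (INF k. ?G (A i) (1 / Suc k)) \<partial>count_space UNIV)"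
    proof (rule nn_integral_monotone_convergence_INF_decseq[symmetric, where i = 0])
      show "decseq (\<lambda>k i. ?G (A i) (1 / Suc k))"
        by (intro decseq_SucI le_funI emeasure_local_parallel_set_ratio_mono bor Ai) (auto simp: frac_le)
      \<comment> \<open>Decreasing convergence needs a finite starting value: at radius 1 the sum is
        the volume of a bounded shell.\<close>
      have "(\<integral>\<^sup>+i. ?G (A i) (1 / Suc 0) \<partial>count_space UNIV) = ?G (\<Union>(range A)) 1"
        by (simp only: nn_integral_count_space_nat Gsum[symmetric]) simp
      also have "\<dots> < \<infinity>"
        using bor[OF A(3)] by (subst emeasure_local_parallel_set_ratio) auto
      finally show "(\<integral>\<^sup>+i. ?G (A i) (1 / Suc 0) \<partial>count_space UNIV) < \<infinity>" .
    qed simp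
    also have "\<dots> = (\<Sum>i. ?S (A i))"
      by (simp add: nn_integral_count_space_nat S_nat[OF Ai])
    finally show "(\<Sum>i. ?S (A i)) = ?S (\<Union>(range A))" ..
  qed
  have sub: "?M \<subseteq> Pow (sphere 0 1)" by (auto simp: sets_restrict_space)
  have sig: "sigma_sets (sphere 0 1) ?M = ?M"
    using sets.sigma_sets_eq[of "restrict_space borel (sphere (0::'a) 1)"]
    by (simp add: space_restrict_space)
  show "emeasure (surface_area_measure K) E = ?S E"
    unfolding surface_area_measure_def
    by (rule emeasure_measure_of[OF refl sub]) (use sub sig pos add assms in auto)
  then show ?eq using S[OF assms] by simp
qed

lemma sets_surface_area_measure [simp, measurable_cong]:
  "sets (surface_area_measure K) = sets (restrict_space borel (sphere 0 1))"
  using sets.sigma_sets_eq[of "restrict_space borel (sphere (0::'a) 1)"]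
    sets.space_closed[of "restrict_space borel (sphere (0::'a) 1)"]
  by (simp add: surface_area_measure_def space_restrict_space)

lemma space_surface_area_measure [simp]: "space (surface_area_measure K) = sphere 0 1"
  using sets_eq_imp_space_eq[OF sets_surface_area_measure] by (simp add: space_restrict_space)

lemma borel_if_surface_area_measurable: "E \<in> sets (surface_area_measure K) \<Longrightarrow> E \<in> sets borel"
  by (simp add: sets_restrict_space_iff)

text \<open>The limit is an infimum, so every radius gives an upper bound; this also yields
  finiteness of the measure.\<close>

lemma emeasure_surface_area_measure_le:
  assumes "E \<in> sets (surface_area_measure K)" "0 < r"
  shows "emeasure (surface_area_measure K) E \<le> ennreal (measure lebesgue (shell K E 0 r) / r)"
  using assms borel_if_surface_area_measurable[OF assms(1)]
  by (subst emeasure_surface_area_measure)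
     (auto intro!: INF_lower2[of r] simp: emeasure_local_parallel_set_ratio)

lemma finite_measure_surface_area_measure: "finite_measure (surface_area_measure K)"
proof
  show "emeasure (surface_area_measure K) (space (surface_area_measure K)) \<noteq> \<infinity>"
    using emeasure_surface_area_measure_le[OF sets.top, of 1]
    by (auto simp: top_unique)
qed

lemma measure_surface_area_measure_le:
  assumes "E \<in> sets (surface_area_measure K)" "0 < r"
  shows "r * measure (surface_area_measure K) E \<le> measure lebesgue (shell K E 0 r)"
  using emeasure_surface_area_measure_le[OF assms] assms(2) 
    finite_measure.emeasure_eq_measure[OF finite_measure_surface_area_measure, of E]
  by (simp add: field_simps)

lemma tendsto_measure_surface_area_measure:
  assumes E: "E \<in> sets (surface_area_measure K)"
  shows "((\<lambda>r. measure lebesgue (shell K E 0 r) / r) \<longlongrightarrow> measure (surface_area_measure K) E) (at_right 0)"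
proof -
  let ?G = "\<lambda>r. emeasure lebesgue (local_parallel_set K r E) / ennreal r"
  have "(?G \<longlongrightarrow> (INF r\<in>{0<..}. ?G r)) (at_right 0)"
    using emeasure_local_parallel_set_ratio_mono[OF borel_if_surface_area_measurable[OF E]]
    by (intro tendsto_INF_at_right_0) auto
  also have "(INF r\<in>{0<..}. ?G r) = ennreal (measure (surface_area_measure K) E)"
    using E emeasure_surface_area_measure(1)[of E]
      finite_measure.emeasure_eq_measure[OF finite_measure_surface_area_measure, of E] by simp
  finally have "((\<lambda>r. ennreal (measure lebesgue (shell K E 0 r) / r)) \<longlongrightarrow> ennreal (measure (surface_area_measure K) E)) (at_right 0)"
    by (rule tendsto_cong[THEN iffD1, rotated])
       (use eventually_at_right_less[of 0] in eventually_elim, 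
        simp add: emeasure_local_parallel_set_ratio[OF borel_if_surface_area_measurable[OF E]])
  then show ?thesis
    by (rule tendsto_ennrealD) (use eventually_at_right_less[of 0] in \<open>auto elim!: eventually_mono\<close>)
qed

end

section \<open>Integrals of support functions\<close>

text \<open>Rounding \<open>g\<close> down to multiples of \<open>1 / N\<close> gives a step
  function within \<open>1 / N\<close> of \<open>g\<close>, with level sets \<open>E i\<close> and
  largest possible index \<open>m\<close>.\<close>

lemma integral_floor_approx:
  fixes g :: "'b \<Rightarrow> real"
  assumes M: "finite_measure M" and g [measurable]: "g \<in> borel_measurable M"
    and bnd: "\<And>x. x \<in> space M \<Longrightarrow> 0 \<le> g x \<and> g x \<le> R" and N: "0 < N"
  defines "E \<equiv> \<lambda>i. {x \<in> space M. nat \<lfloor>N * g x\<rfloor> = i}"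
    and "m \<equiv> nat \<lfloor>N * R\<rfloor>"
  shows "(\<Sum>i\<le>m. real i / N * measure M (E i)) \<le> (\<integral>x. g x \<partial>M)"
    and "(\<integral>x. g x \<partial>M) \<le> (\<Sum>i\<le>m. real i / N * measure M (E i)) + measure M (space M) / N"
    and "(\<Sum>i\<le>m. measure M (E i)) = measure M (space M)"
    and "\<And>x. x \<in> space M \<Longrightarrow> nat \<lfloor>N * g x\<rfloor> \<le> m"
proof -
  interpret finite_measure M by (rule M)
  have E [measurable]: "E i \<in> sets M" for i unfolding E_def by measurable
  show le: "nat \<lfloor>N * g x\<rfloor> \<le> m" if "x \<in> space M" for x
    unfolding m_def using bnd[OF that] N by (intro nat_mono floor_mono mult_left_mono) auto
  have disj: "disjoint_family_on E {..m}" by (auto simp: disjoint_family_on_def E_def)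
  have UE: "(\<Union>i\<le>m. E i) = space M" using le by (auto simp: E_def)
  show "(\<Sum>i\<le>m. measure M (E i)) = measure M (space M)"
    unfolding UE[symmetric] by (rule finite_measure_finite_Union[symmetric]) (use disj in auto)
  define s where "s x = (\<Sum>i\<le>m. real i / N * indicator (E i) x)" for x
  have s: "s x = real (nat \<lfloor>N * g x\<rfloor>) / N" if "x \<in> space M" for x
  proof -
    have "s x = (\<Sum>i\<in>{nat \<lfloor>N * g x\<rfloor>}. real i / N * indicator (E i) x)"
      unfolding s_def using le[OF that] by (intro sum.mono_neutral_right) (auto simp: E_def)
    then show ?thesis using that by (simp add: E_def)
  qed
  have bounds: "s x \<le> g x" "g x \<le> s x + 1 / N" if "x \<in> space M" for x
  proof -
    have "0 \<le> N * g x" using bnd[OF that] N by simp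
    then have "real (nat \<lfloor>N * g x\<rfloor>) \<le> N * g x" "N * g x \<le> real (nat \<lfloor>N * g x\<rfloor>) + 1"
      by linarith+
    then show "s x \<le> g x" "g x \<le> s x + 1 / N"
      unfolding s[OF that] using N by (simp_all add: field_simps)
  qed
  have ig: "integrable M g"
    using bnd by (intro integrable_const_bound[where B = R]) auto
  have int_s: "integrable M s"
    unfolding s_def by (intro Bochner_Integration.integrable_sum integrable_mult_right) (auto simp: emeasure_eq_measure)
  have si: "(\<integral>x. s x \<partial>M) = (\<Sum>i\<le>m. real i / N * measure M (E i))"
    unfolding s_def
    by (subst Bochner_Integration.integral_sum) (auto simp: emeasure_eq_measure)
  show "(\<Sum>i\<le>m. real i / N * measure M (E i)) \<le> (\<integral>x. g x \<partial>M)"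
    unfolding si[symmetric] using bounds by (intro integral_mono int_s ig)
  have "(\<integral>x. g x \<partial>M) \<le> (\<integral>x. s x + 1 / N \<partial>M)"
    using bounds int_s by (intro integral_mono ig) auto
  also have "\<dots> = (\<Sum>i\<le>m. real i / N * measure M (E i)) + measure M (space M) / N"
    using int_s by (simp add: si)
  finally show "(\<integral>x. g x \<partial>M) \<le> (\<Sum>i\<le>m. real i / N * measure M (E i)) + measure M (space M) / N" .
qed

section \<open>Elementary properties of support functions\<close>

lemma support_function_ge:
  assumes "bounded L" "y \<in> L"
  shows "x \<bullet> y \<le> support_function L x"
proof -
  have "bounded ((\<bullet>) x ` L)"
    using assms(1) by (intro bounded_linear_image bounded_linear_inner_right)
  then show ?thesis
    unfolding support_function_def using assms(2)
    by (intro cSUP_upper bounded_imp_bdd_above)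
qed

lemma support_function_le:
  assumes "L \<noteq> {}" "\<And>y. y \<in> L \<Longrightarrow> x \<bullet> y \<le> c"
  shows "support_function L x \<le> c"
  unfolding support_function_def using assms by (intro cSUP_least)

lemma support_function_le_norm:
  assumes "L \<noteq> {}" "\<And>y. y \<in> L \<Longrightarrow> norm y \<le> R"
  shows "support_function L x \<le> norm x * R"
proof (rule support_function_le[OF assms(1)])
  fix y assume "y \<in> L"
  then show "x \<bullet> y \<le> norm x * R"
    using norm_cauchy_schwarz[of x y] assms(2)[of y] by (meson mult_left_mono norm_ge_zero order_trans)
qed

text \<open>A finite supremum of linear functions is convex, and a finite convex function on the
  whole space is continuous.\<close>

lemma continuous_on_support_function:
  assumes L: "bounded L" "L \<noteq> {}"
  shows "continuous_on A (support_function L)"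
proof -
  have "convex_on UNIV (support_function L)"
  proof (rule convex_onI)
    fix t :: real and x y :: 'a assume t: "0 < t" "t < 1"
    show "support_function L ((1 - t) *\<^sub>R x + t *\<^sub>R y)
      \<le> (1 - t) * support_function L x + t * support_function L y"
    proof (rule support_function_le[OF L(2)])
      fix z assume "z \<in> L"
      then show "((1 - t) *\<^sub>R x + t *\<^sub>R y) \<bullet> z \<le> (1 - t) * support_function L x + t * support_function L y"
        using support_function_ge[OF L(1), of z x] support_function_ge[OF L(1), of z y] t
        by (simp add: inner_add_left add_mono mult_left_mono)
    qed
  qed simp
  then have "continuous_on UNIV (support_function L)"
    by (intro convex_on_continuous) auto
  then show ?thesis by (rule continuous_on_subset) simp
qed

section \<open>First variation of volume and the surface area measure\<close>

context
  fixes K :: "'a::euclidean_space set"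
  assumes K: "compact K" "convex K" "K \<noteq> {}"
begin

lemma support_function_measurable_surface [measurable]:
  assumes "bounded L" "L \<noteq> {}"
  shows "support_function L \<in> borel_measurable (surface_area_measure K)"
proof -
  have "support_function L \<in> borel_measurable (restrict_space borel (sphere 0 1))"
    using continuous_on_support_function[OF assms, of UNIV]
    by (intro measurable_restrict_space1 borel_measurable_continuous_onI)
  then show ?thesis
    using measurable_cong_sets[OF sets_surface_area_measure[OF K] refl] by blast
qed

text \<open>For the direction \<open>u\<close> at \<open>x = y + e z\<close>, the value
  \<open>u . x\<close> equals \<open>h_K(u) + d(x)\<close> and is at most
  \<open>h_K(u) + e h_L(u)\<close>.\<close>

lemma infdist_le_support_function:
  assumes L: "bounded L" and e: "0 \<le> e" and x: "x = y + e *\<^sub>R z" "y \<in> K" "z \<in> L" "x \<notin> K"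
  shows "infdist x K \<le> e * support_function L (outward_direction K x)"
proof -
  let ?u = "outward_direction K x"
  have "support_function K ?u + infdist x K = ?u \<bullet> y + e * (?u \<bullet> z)"
    using inner_outward_direction[OF compact_imp_closed[OF K(1)] K(2,3) x(4)] x(1)
    by (simp add: inner_add_right)
  moreover have "?u \<bullet> y \<le> support_function K ?u"
    using support_function_ge[OF compact_imp_bounded[OF K(1)] x(2)] .
  moreover have "e * (?u \<bullet> z) \<le> e * support_function L ?u"
    using support_function_ge[OF L x(3)] e by (intro mult_left_mono)
  ultimately show ?thesis by linarith
qed

text \<open>Bounds the growth of the volume of \<open>K + e L\<close> at \<open>e = 0\<close> from
  above; the arbitrary rate \<open>c\<close> is the slot for the lower bound from
  Brunn-Minkowski.\<close>

lemma le_integral_support_function: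
  assumes L: "compact L" "0 \<in> L"
    and c: "\<And>e. 0 < e \<Longrightarrow> measure lebesgue K + e * c
      \<le> measure lebesgue ((\<lambda>(y, z). y + e *\<^sub>R z) ` (K \<times> L))"
  shows "c \<le> (\<integral>u. support_function L u \<partial>surface_area_measure K)"
proof -
  let ?S = "surface_area_measure K" and ?h = "support_function L"
  have cl: "closed K" using K compact_imp_closed by blast
  have bL: "bounded L" "L \<noteq> {}" using L compact_imp_bounded by auto
  obtain R where R: "\<And>y. y \<in> L \<Longrightarrow> norm y \<le> R" using bL bounded_iff by metis
  have bnd: "0 \<le> ?h u \<and> ?h u \<le> R" if "u \<in> space ?S" for u
    using support_function_ge[OF bL(1) L(2), of u] support_function_le_norm[OF bL(2) R, of u] that
    by (simp add: space_surface_area_measure[OF K])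
  have m: "?h \<in> borel_measurable ?S" using bL by measurable
  have fin: "finite_measure ?S" using finite_measure_surface_area_measure[OF K] .
  have approx: "c \<le> (\<integral>u. ?h u \<partial>?S) + measure ?S (space ?S) / real (Suc n)" for n
  proof -
    define N where "N = real (Suc n)"
    have N: "N > 0" by (simp add: N_def)
    define E where "E i = {x \<in> space ?S. nat \<lfloor>N * ?h x\<rfloor> = i}" for i
    define k where "k = nat \<lfloor>N * R\<rfloor>"
    note fa = integral_floor_approx[OF fin m bnd N, folded E_def k_def]
    have E: "E i \<in> sets ?S" for i unfolding E_def using m by measurable
    note Eb = borel_if_surface_area_measurable[OF K E]
    \<comment> \<open>The floor rounds \<open>N * h_L\<close> down, so the shell over
      \<open>E i\<close> gets the width belonging to \<open>i + 1\<close> in order to contain all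
      points of \<open>K + e L\<close> outside \<open>K\<close> with direction in
      \<open>E i\<close>.\<close>
    have le: "c \<le> (\<Sum>i\<le>k. measure lebesgue (shell K (E i) 0 (e * (real (i + 1) / N))) / e)" if e: "0 < e" for e
    proof -
      let ?KL = "(\<lambda>(y, z). y + e *\<^sub>R z) ` (K \<times> L)"
      let ?sh = "\<lambda>i. shell K (E i) 0 (e * (real (i + 1) / N))"
      have sub: "?KL \<subseteq> K \<union> (\<Union>i\<le>k. ?sh i)"
      proof clarify
        fix y z assume yz: "y \<in> K" "z \<in> L" and nin: "y + e *\<^sub>R z \<notin> (\<Union>i\<le>k. ?sh i)"
        show "y + e *\<^sub>R z \<in> K"
        proof (rule ccontr)
          define x where "x = y + e *\<^sub>R z"
          assume "y + e *\<^sub>R z \<notin> K"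
          then have x: "x \<notin> K" by (simp add: x_def)
          let ?u = "outward_direction K x"
          have u: "?u \<in> space ?S"
            using norm_outward_direction[OF cl K(2,3) x] by (simp add: space_surface_area_measure[OF K])
          define i where "i = nat \<lfloor>N * ?h ?u\<rfloor>"
          have "N * ?h ?u \<le> real (i + 1)" unfolding i_def by linarith
          then have "?h ?u \<le> real (i + 1) / N" using N by (simp add: field_simps)
          then have "e * ?h ?u \<le> e * (real (i + 1) / N)" using e by (intro mult_left_mono) auto
          then have "infdist x K \<le> e * (real (i + 1) / N)"
            using infdist_le_support_function[OF bL(1) _ x_def yz x] e by linarith
          then have "x \<in> ?sh i"
            using infdist_pos_iff[OF cl K(2,3), of x] x u by (simp add: shell_def E_def i_def)
          moreover have "i \<le> k" using fa(4)[of ?u] u by (simp add: i_def)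
          ultimately show False using nin by (auto simp: x_def)
        qed
      qed
      have shm: "?sh i \<in> lmeasurable" for i by (rule shell_lmeasurable[OF K Eb]) simp
      have Km: "K \<in> lmeasurable" using K(1) by (rule lmeasurable_compact)
      have "compact ((\<lambda>p. fst p + e *\<^sub>R snd p) ` (K \<times> L))"
        using K(1) L(1) by (intro compact_continuous_image compact_Times continuous_intros)
      then have KLm: "?KL \<in> lmeasurable" by (simp add: case_prod_beta' lmeasurable_compact)
      have "measure lebesgue ?KL \<le> measure lebesgue (K \<union> (\<Union>i\<le>k. ?sh i))"
        using KLm Km shm sub by (intro measure_mono_fmeasurable fmeasurable.Un fmeasurable.finite_UN) (auto intro: fmeasurableD)
      also have "\<dots> \<le> measure lebesgue K + measure lebesgue (\<Union>i\<le>k. ?sh i)"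
        using Km shm by (intro measure_Un_le) (auto intro!: fmeasurableD fmeasurable.finite_UN)
      also have "measure lebesgue (\<Union>i\<le>k. ?sh i) \<le> (\<Sum>i\<le>k. measure lebesgue (?sh i))"
        using shm by (intro measure_UNION_le) (auto intro: fmeasurableD)
      finally have "e * c \<le> (\<Sum>i\<le>k. measure lebesgue (?sh i))" using c[OF e] by linarith
      then show ?thesis using e by (simp add: sum_divide_distrib[symmetric] field_simps)
    qed
    \<comment> \<open>Rescaling the radius by \<open>(i + 1) / N\<close> turns each quotient into
      the one that defines the surface area measure of \<open>E i\<close>.\<close>
    have "((\<lambda>e. \<Sum>i\<le>k. measure lebesgue (shell K (E i) 0 (e * (real (i + 1) / N))) / e)
      \<longlongrightarrow> (\<Sum>i\<le>k. real (i + 1) / N * measure ?S (E i))) (at_right 0)"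
    proof (intro tendsto_sum)
      fix i
      define b where "b = real (i + 1) / N"
      have b: "b > 0" using N by (simp add: b_def)
      have "filterlim (\<lambda>e. e * b) (at_right 0) (at_right 0)"
        using b by (auto simp: filterlim_at eventually_at_right_less eventually_mono[OF eventually_at_right_less]
          intro!: tendsto_eq_intros)
      then have "((\<lambda>e. b * (measure lebesgue (shell K (E i) 0 (e * b)) / (e * b))) \<longlongrightarrow> b * measure ?S (E i)) (at_right 0)"
        using tendsto_measure_surface_area_measure[OF K E[of i]]
        by (intro tendsto_mult tendsto_const) (rule filterlim_compose[rotated])
      then show "((\<lambda>e. measure lebesgue (shell K (E i) 0 (e * (real (i + 1) / N))) / e) \<longlongrightarrow> real (i + 1) / N * measure ?S (E i)) (at_right 0)"
        using b unfolding b_def[symmetric] by simp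
    qed
    then have "c \<le> (\<Sum>i\<le>k. real (i + 1) / N * measure ?S (E i))"
      by (rule tendsto_lowerbound) (use le in \<open>auto intro: eventually_mono[OF eventually_at_right_less]\<close>)
    \<comment> \<open>The excess of \<open>i + 1\<close> over \<open>i\<close> costs the total mass
      divided by \<open>N\<close>, which vanishes as \<open>N\<close> grows.\<close>
    also have "\<dots> = (\<Sum>i\<le>k. real i / N * measure ?S (E i)) + (\<Sum>i\<le>k. measure ?S (E i)) / N"
      by (simp add: add_divide_distrib distrib_right sum.distrib sum_divide_distrib)
    also have "\<dots> \<le> (\<integral>u. ?h u \<partial>?S) + measure ?S (space ?S) / N"
      using fa(1,3) by simp
    finally show ?thesis by (simp add: N_def)
  qed
  have "(\<lambda>n. (\<integral>u. ?h u \<partial>?S) + measure ?S (space ?S) / real (Suc n)) \<longlonglongrightarrow> (\<integral>u. ?h u \<partial>?S) + 0"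
    by (intro tendsto_intros LIMSEQ_Suc[OF lim_const_over_n])
  then have "c \<le> (\<integral>u. ?h u \<partial>?S) + 0"
    by (rule LIMSEQ_le_const) (use approx in auto)
  then show ?thesis by simp
qed

text \<open>The parallel body \<open>?P r\<close> is compared with its contraction by
  \<open>1 / (1 + t)\<close>. In direction \<open>u\<close> the contraction clears an outer layer
  whose depth is at least \<open>t\<close> times \<open>h_K(u)\<close> rounded down. By the shift
  inequality this layer has at least the volume of an equally deep layer next to \<open>K\<close>,
  hence at least depth times surface measure.\<close>

lemma integral_support_function_self_le:
  assumes 0: "0 \<in> K"
  shows "(\<integral>u. support_function K u \<partial>surface_area_measure K) \<le> real DIM('a) * measure lebesgue K"
proof -
  let ?S = "surface_area_measure K" and ?h = "support_function K"
  let ?P = "\<lambda>r. {x. infdist x K \<le> r}"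
  have cl: "closed K" using K compact_imp_closed by blast
  have bK: "bounded K" using K compact_imp_bounded by auto
  obtain R where R: "\<And>y. y \<in> K \<Longrightarrow> norm y \<le> R" using bK bounded_iff by metis
  have bnd: "0 \<le> ?h u \<and> ?h u \<le> R" if "u \<in> space ?S" for u
    using support_function_ge[OF bK 0, of u] support_function_le_norm[OF K(3) R, of u] that
    by (simp add: space_surface_area_measure[OF K])
  have m: "?h \<in> borel_measurable ?S" using bK K by measurable
  have fin: "finite_measure ?S" using finite_measure_surface_area_measure[OF K] .
  have Pc: "compact (?P r)" for r
    using bounded_infdist_le[OF K, of r]
    by (auto simp: compact_eq_bounded_closed intro!: closed_Collect_le continuous_intros)
  then have Pm: "?P r \<in> lmeasurable" for r by (rule lmeasurable_compact)
  have approx: "(\<integral>u. ?h u \<partial>?S) \<le> real DIM('a) * measure lebesgue (?P r) + measure ?S (space ?S) / real (Suc n)"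
    if r: "0 < r" for r n
  proof -
    define N where "N = real (Suc n)"
    have N: "N > 0" by (simp add: N_def)
    define E where "E i = {x \<in> space ?S. nat \<lfloor>N * ?h x\<rfloor> = i}" for i
    define k where "k = nat \<lfloor>N * R\<rfloor>"
    note fa = integral_floor_approx[OF fin m bnd N, folded E_def k_def]
    have E: "E i \<in> sets ?S" for i unfolding E_def using m by measurable
    note Eb = borel_if_surface_area_measurable[OF K E]
    \<comment> \<open>With this choice a layer of depth \<open>t * (i / N)\<close> with
      \<open>i \<le> k\<close> has depth at most \<open>r\<close>, so it fits between
      \<open>K\<close> and the boundary of \<open>?P r\<close>.\<close>
    define t where "t = r * N / (real k + 1)"
    have t: "t > 0" using r N by (simp add: t_def)
    have tk: "t * (real i / N) \<le> r" if "i \<le> k" for i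
      proof -
      have "r * real i \<le> r * (real k + 1)" using that r by (intro mult_left_mono) auto
      then show ?thesis using N by (simp add: t_def field_simps)
    qed
    define Q where "Q = (\<lambda>x. (1 / (1 + t)) *\<^sub>R x + 0) ` ?P r"
    have Ql: "Q \<in> lmeasurable"
      unfolding Q_def by (intro lmeasurable_compact compact_continuous_image Pc continuous_intros)
    let ?sh = "\<lambda>i. shell K (E i) (r - t * (real i / N)) r"
    have QP: "Q \<subseteq> ?P r"
    proof
      fix x assume "x \<in> Q"
      then obtain y where y: "infdist y K \<le> r" "x = (1 / (1 + t)) *\<^sub>R y" by (auto simp: Q_def)
      obtain q where q: "q \<in> K" "infdist y K = dist y q" using infdist_attains_inf[OF cl K(3), of y] by auto
      have "(1 / (1 + t)) *\<^sub>R q \<in> K"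
        using convexD_alt[OF K(2) 0 q(1), of "1 / (1 + t)"] t by simp
      then have "infdist x K \<le> dist x ((1 / (1 + t)) *\<^sub>R q)" by (rule infdist_le)
      also have "\<dots> = (1 / (1 + t)) * dist y q"
        using t unfolding y(2) by (simp add: dist_norm flip: scaleR_diff_right)
      also have "\<dots> \<le> 1 * dist y q" using t by (intro mult_right_mono) auto
      finally show "x \<in> ?P r" using q y by simp
    qed
    have Qm: "measure lebesgue Q = (1 / (1 + t)) ^ DIM('a) * measure lebesgue (?P r)"
      unfolding Q_def measure_lebesgue_affine using t by simp
    have shm: "?sh i \<in> lmeasurable" if "i \<le> k" for i
      using tk[OF that] by (intro shell_lmeasurable[OF K Eb]) simp
    have sub: "(\<Union>i\<le>k. ?sh i) \<subseteq> ?P r - Q"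
    proof
      fix x assume "x \<in> (\<Union>i\<le>k. ?sh i)"
      then obtain i where i: "i \<le> k" "r - t * (real i / N) < infdist x K" "infdist x K \<le> r"
        "outward_direction K x \<in> E i"
        by (auto simp: shell_def)
      let ?u = "outward_direction K x"
      have "0 < infdist x K" using tk[OF i(1)] i(2) by linarith
      then have x: "x \<notin> K" using infdist_pos_iff[OF cl K(2,3)] by auto
      have "0 \<le> N * ?h ?u" using i(4) bnd[of ?u] N by (auto simp: E_def)
      then have "real i \<le> N * ?h ?u" using i(4) by (auto simp: E_def)
      then have "real i / N \<le> ?h ?u" using N by (simp add: field_simps)
      also have "\<dots> \<le> ?u \<bullet> x" using inner_outward_direction[OF cl K(2,3) x] infdist_nonneg[of x K] by linarith
      finally have "t * (real i / N) \<le> t * (?u \<bullet> x)" using t by (intro mult_left_mono) auto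
      \<comment> \<open>By convexity, dilating \<open>x\<close> by \<open>1 + t\<close> raises its
        distance by at least \<open>t * (?u \<bullet> x)\<close>, which here carries it beyond
        \<open>r\<close>.\<close>
      moreover have "infdist x K + t * (?u \<bullet> x) \<le> infdist ((1 + t) *\<^sub>R x) K"
        using infdist_subgradient[OF cl K(2,3) x, of "(1 + t) *\<^sub>R x"] by (simp add: algebra_simps)
      ultimately have "r < infdist ((1 + t) *\<^sub>R x) K" using i(2) by linarith
      then have "x \<notin> Q" using t by (auto simp: Q_def)
      then show "x \<in> ?P r - Q" using i by simp
    qed
    have "(\<Sum>i\<le>k. t * (real i / N) * measure ?S (E i)) \<le> (\<Sum>i\<le>k. measure lebesgue (?sh i))"
    proof (intro sum_mono)
      fix i assume i: "i \<in> {..k}"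
      show "t * (real i / N) * measure ?S (E i) \<le> measure lebesgue (?sh i)"
      proof (cases "i = 0")
        case False
        then have pos: "0 < t * (real i / N)" using t N by simp
        have "t * (real i / N) * measure ?S (E i) \<le> measure lebesgue (shell K (E i) 0 (t * (real i / N)))"
          by (rule measure_surface_area_measure_le[OF K E pos])
        also have "\<dots> \<le> measure lebesgue (?sh i)"
          using measure_shell_shift[OF K Eb, of 0 "r - t * (real i / N)" i "t * (real i / N)"] tk i by simp
        finally show ?thesis .
      qed simp
    qed
    also have "\<dots> = measure lebesgue (\<Union>i\<le>k. ?sh i)"
      using shm by (intro measure_UNION'[symmetric]) (auto simp: pairwise_def disjnt_def shell_def E_def)
    also have "\<dots> \<le> measure lebesgue (?P r - Q)"
    proof -
      show ?thesis
        using Ql sub shm Pm by (intro measure_mono_fmeasurable) (auto intro!: fmeasurableD fmeasurable.Diff fmeasurable.finite_UN)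
    qed
    also have "\<dots> = measure lebesgue (?P r) - measure lebesgue Q"
      using Pm[of r] QP Ql by (intro measurable_measure_Diff) (auto intro: fmeasurableD)
    also have "\<dots> = (1 - (1 / (1 + t)) ^ DIM('a)) * measure lebesgue (?P r)"
      by (simp add: Qm algebra_simps)
    also have "\<dots> \<le> (real DIM('a) * t) * measure lebesgue (?P r)"
    proof (intro mult_right_mono)
      \<comment> \<open>Bernoulli's inequality gives a bound linear in \<open>t\<close> for every
        \<open>t > 0\<close>, so \<open>t\<close> cancels below without a limit.\<close>
      have "1 + real DIM('a) * (1 / (1 + t) - 1) \<le> (1 + (1 / (1 + t) - 1)) ^ DIM('a)"
        using t by (intro Bernoulli_inequality) auto
      moreover have "1 - 1 / (1 + t) \<le> t" using t by (simp add: field_simps)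
      then have "real DIM('a) * (1 - 1 / (1 + t)) \<le> real DIM('a) * t" by (intro mult_left_mono) auto
      ultimately show "1 - (1 / (1 + t)) ^ DIM('a) \<le> real DIM('a) * t" by (simp add: algebra_simps)
    qed simp
    finally have "t * (\<Sum>i\<le>k. real i / N * measure ?S (E i)) \<le> t * (real DIM('a) * measure lebesgue (?P r))"
      by (simp add: sum_distrib_left mult_ac)
    then have "(\<Sum>i\<le>k. real i / N * measure ?S (E i)) \<le> real DIM('a) * measure lebesgue (?P r)"
      using t by (simp only: mult_le_cancel_left_pos)
    then show ?thesis using fa(2) by (simp add: N_def)
  qed
  have le: "(\<integral>u. ?h u \<partial>?S) \<le> real DIM('a) * measure lebesgue (?P r)" if "0 < r" for r
  proof -
    have "(\<lambda>n. real DIM('a) * measure lebesgue (?P r) + measure ?S (space ?S) / real (Suc n))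
       \<longlonglongrightarrow> real DIM('a) * measure lebesgue (?P r) + 0"
      by (intro tendsto_intros LIMSEQ_Suc[OF lim_const_over_n])
    then have "(\<integral>u. ?h u \<partial>?S) \<le> real DIM('a) * measure lebesgue (?P r) + 0"
      by (rule LIMSEQ_le_const) (use approx[OF that] in auto)
    then show ?thesis by simp
  qed
  \<comment> \<open>Continuity of volume from above, along the closed parallel bodies decreasing to
    \<open>K\<close>, removes \<open>r\<close>.\<close>
  have "(\<Inter>n. ?P (1 / real (Suc n))) = K"
  proof (intro equalityI subsetI)
    fix x assume x: "x \<in> (\<Inter>n. ?P (1 / real (Suc n)))"
    have "infdist x K \<le> 0"
    proof (rule LIMSEQ_le_const)
      show "(\<lambda>n. 1 / real (Suc n)) \<longlonglongrightarrow> 0" by (rule LIMSEQ_Suc[OF lim_1_over_n])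
    qed (use x in auto)
    then show "x \<in> K" using infdist_pos_iff[OF cl K(2,3), of x] by fastforce
  qed auto
  moreover have "(\<lambda>n. measure lebesgue (?P (1 / real (Suc n)))) \<longlonglongrightarrow> measure lebesgue (\<Inter>n. ?P (1 / real (Suc n)))"
  proof (rule Lim_measure_decseq)
    show "decseq (\<lambda>n. ?P (1 / real (Suc n)))"
    proof (rule decseq_SucI, rule subsetI)
      fix n x assume "x \<in> ?P (1 / real (Suc (Suc n)))"
      moreover have "1 / real (Suc (Suc n)) \<le> 1 / real (Suc n)" by (simp add: frac_le)
      ultimately show "x \<in> ?P (1 / real (Suc n))" by (simp del: of_nat_Suc)
    qed
    show "emeasure lebesgue (?P (1 / real (Suc n))) \<noteq> \<infinity>" for n
      unfolding infinity_ennreal_def by (rule fmeasurableD2[OF Pm])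
  qed (use Pm in \<open>auto intro: fmeasurableD\<close>)
  ultimately have "(\<lambda>n. real DIM('a) * measure lebesgue (?P (1 / real (Suc n)))) \<longlonglongrightarrow> real DIM('a) * measure lebesgue K"
    by (intro tendsto_mult tendsto_const) simp
  then show ?thesis
    by (rule LIMSEQ_le_const) (use le in auto)
qed

end

section \<open>The Brunn-Minkowski inequality\<close>

text \<open>The Brunn-Minkowski lower bound for the volume of a sum of sets of volumes
  \<open>x\<close> and \<open>y\<close>. As an \<open>n\<close>-th power it is homogeneous of degree
  one in the pair, which lets the two halves of a cut be added.\<close>

definition bm_sum :: "nat \<Rightarrow> real \<Rightarrow> real \<Rightarrow> real" where
  "bm_sum n x y = (root n x + root n y) ^ n"

lemma bm_sum_commute: "bm_sum n x y = bm_sum n y x"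
  by (simp add: bm_sum_def add.commute)

lemma bm_sum_scale: "0 < n \<Longrightarrow> 0 \<le> c \<Longrightarrow> bm_sum n (c * x) (c * y) = c * bm_sum n x y"
  by (simp add: bm_sum_def real_root_mult power_mult_distrib flip: distrib_left)

text \<open>The inequality of arithmetic and geometric means, applied to the ratios
  \<open>l i / (l i + m i)\<close> and to \<open>m i / (l i + m i)\<close>; the two arithmetic means
  add up to 1.\<close>

lemma bm_sum_prod_le:
  fixes l m :: "'b \<Rightarrow> real"
  assumes I: "finite I" "I \<noteq> {}" and pos: "\<And>i. i \<in> I \<Longrightarrow> 0 < l i \<and> 0 < m i"
  shows "bm_sum (card I) (\<Prod>i\<in>I. l i) (\<Prod>i\<in>I. m i) \<le> (\<Prod>i\<in>I. l i + m i)"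
proof -
  let ?n = "card I"
  define P where "P = (\<Prod>i\<in>I. l i + m i)"
  have n: "0 < ?n" using I by (simp add: card_gt_0_iff)
  have P: "P > 0" unfolding P_def using pos by (intro prod_pos) (auto intro: add_pos_pos)
  have *: "root ?n (\<Prod>i\<in>I. f i) \<le> root ?n P * (\<Sum>i\<in>I. f i / (l i + m i)) / ?n"
    if f: "\<And>i. i \<in> I \<Longrightarrow> 0 < f i" for f :: "'b \<Rightarrow> real"
  proof -
    have q: "0 < f i / (l i + m i)" if "i \<in> I" for i using f[OF that] pos[OF that] by simp
    have "(\<Prod>i\<in>I. f i) = P * (\<Prod>i\<in>I. f i / (l i + m i))"
      using P by (simp add: P_def prod_dividef)
    moreover have "root ?n (\<Prod>i\<in>I. f i / (l i + m i)) \<le> (\<Sum>i\<in>I. f i / (l i + m i)) / ?n"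
      using arith_geom_mean[OF I, of "\<lambda>i. f i / (l i + m i)"] q n
      by (simp add: root_powr_inverse prod_pos sum_divide_distrib less_imp_le inverse_eq_divide)
    ultimately show ?thesis
      using P n mult_left_mono[of "root ?n (\<Prod>i\<in>I. f i / (l i + m i))" "(\<Sum>i\<in>I. f i / (l i + m i)) / ?n" "root ?n P"]
      by (simp add: real_root_mult)
  qed
  have "root ?n (\<Prod>i\<in>I. l i) + root ?n (\<Prod>i\<in>I. m i)
    \<le> root ?n P * (\<Sum>i\<in>I. l i / (l i + m i)) / ?n + root ?n P * (\<Sum>i\<in>I. m i / (l i + m i)) / ?n"
    using pos by (intro add_mono *) auto
  also have "\<dots> = root ?n P * (\<Sum>i\<in>I. l i / (l i + m i) + m i / (l i + m i)) / ?n"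
    by (simp add: sum.distrib distrib_left add_divide_distrib)
  also have "(\<Sum>i\<in>I. l i / (l i + m i) + m i / (l i + m i)) = (\<Sum>i\<in>I. 1)"
    using pos by (intro sum.cong refl) (metis add_divide_distrib add_pos_pos divide_self less_irrefl)
  also have "root ?n P * (\<Sum>i\<in>I. 1) / ?n = root ?n P" using n by simp
  finally have "bm_sum ?n (\<Prod>i\<in>I. l i) (\<Prod>i\<in>I. m i) \<le> root ?n P ^ ?n"
    unfolding bm_sum_def using pos
    by (intro power_mono add_nonneg_nonneg) (auto intro!: prod_nonneg simp: n less_imp_le)
  then show ?thesis using n P by (simp add: P_def)
qed

definition set_sum :: "'a::real_vector set \<Rightarrow> 'a set \<Rightarrow> 'a set" where
  "set_sum A B = (\<Union>x\<in>A. \<Union>y\<in>B. {x + y})"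

lemma mem_set_sum: "z \<in> set_sum A B \<longleftrightarrow> (\<exists>x\<in>A. \<exists>y\<in>B. z = x + y)"
  by (auto simp: set_sum_def)

lemma set_sum_commute: "set_sum A B = set_sum B A"
  by (force simp: mem_set_sum set_eq_iff add.commute)

lemma set_sum_mono: "A \<subseteq> A' \<Longrightarrow> B \<subseteq> B' \<Longrightarrow> set_sum A B \<subseteq> set_sum A' B'"
  by (auto simp: set_sum_def)

lemma open_set_sum: "open A \<Longrightarrow> open (set_sum A (B :: 'a::real_normed_vector set))"
  unfolding set_sum_def by (rule open_sums) simp

lemma bounded_set_sum: "bounded A \<Longrightarrow> bounded B \<Longrightarrow> bounded (set_sum A (B :: 'a::real_normed_vector set))"
  unfolding set_sum_def by (rule bounded_sums)

lemma set_sum_box_superset: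
  fixes a b c d :: "'a::euclidean_space"
  assumes ab: "\<And>i. i \<in> Basis \<Longrightarrow> a \<bullet> i < b \<bullet> i" and cd: "\<And>i. i \<in> Basis \<Longrightarrow> c \<bullet> i < d \<bullet> i"
  shows "box (a + c) (b + d) \<subseteq> set_sum (box a b) (box c d)"
proof
  fix z assume z: "z \<in> box (a + c) (b + d)"
  \<comment> \<open>In each coordinate \<open>z\<close> is split at the same relative position
    \<open>t i\<close> in both intervals.\<close>
  define t where "t i = ((z - a - c) \<bullet> i) / ((b - a) \<bullet> i + (d - c) \<bullet> i)" for i
  have t: "0 < t i \<and> t i < 1" if "i \<in> Basis" for i
    using z ab[OF that] cd[OF that] that
    by (auto simp: t_def mem_box inner_diff_left inner_add_left divide_simps)
  define x where "x = (\<Sum>i\<in>Basis. (a \<bullet> i + t i * ((b - a) \<bullet> i)) *\<^sub>R i)"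
  have x: "x \<bullet> i = a \<bullet> i + t i * ((b - a) \<bullet> i)" if "i \<in> Basis" for i
    using that by (simp add: x_def)
  have zx: "(z - x) \<bullet> i = c \<bullet> i + t i * ((d - c) \<bullet> i)" if "i \<in> Basis" for i
  proof -
    have "t i * ((b - a) \<bullet> i + (d - c) \<bullet> i) = (z - a - c) \<bullet> i"
      using ab[OF that] cd[OF that] by (simp add: t_def inner_diff_left)
    then show ?thesis by (simp add: inner_diff_left x[OF that] algebra_simps)
  qed
  have *: "u < u + s * (v - u)" "u + s * (v - u) < v" if "u < v" "0 < s \<and> s < 1" for u v s :: real
  proof -
    show "u < u + s * (v - u)" using that by simp
    have "s * (v - u) < 1 * (v - u)" using that by (intro mult_strict_right_mono) auto
    then show "u + s * (v - u) < v" by simp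
  qed
  have "x \<in> box a b" using *[OF ab t] by (auto simp: mem_box x inner_diff_left)
  moreover have "z - x \<in> box c d" using *[OF cd t] zx by (auto simp: mem_box inner_diff_left[of d c] simp del: inner_diff_left)
  ultimately show "z \<in> set_sum (box a b) (box c d)"
    unfolding mem_set_sum by (intro bexI[of _ x] bexI[of _ "z - x"]) auto
qed

lemma brunn_minkowski_box:
  fixes a b c d :: "'a::euclidean_space"
  assumes ne: "box a b \<noteq> {}" "box c d \<noteq> {}"
  shows "bm_sum DIM('a) (measure lebesgue (box a b)) (measure lebesgue (box c d))
    \<le> measure lebesgue (set_sum (box a b) (box c d))"
proof -
  have ab: "a \<bullet> i < b \<bullet> i" and cd: "c \<bullet> i < d \<bullet> i" if "i \<in> Basis" for i
    using ne that by (auto simp: box_ne_empty)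
  have m: "measure lebesgue (box p q) = (\<Prod>i\<in>Basis. q \<bullet> i - p \<bullet> i)" if "\<And>i. i \<in> Basis \<Longrightarrow> p \<bullet> i < q \<bullet> i" for p q :: 'a
    using that by (subst measure_completion) (auto simp: measure_lborel_box_eq inner_diff_left less_imp_le)
  have mab: "measure lebesgue (box a b) = (\<Prod>i\<in>Basis. b \<bullet> i - a \<bullet> i)" by (rule m) (rule ab)
  have mcd: "measure lebesgue (box c d) = (\<Prod>i\<in>Basis. d \<bullet> i - c \<bullet> i)" by (rule m) (rule cd)
  have "bm_sum DIM('a) (measure lebesgue (box a b)) (measure lebesgue (box c d))
      \<le> (\<Prod>i\<in>Basis. (b \<bullet> i - a \<bullet> i) + (d \<bullet> i - c \<bullet> i))"
    unfolding mab mcd using ab cd by (intro bm_sum_prod_le) auto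
  also have "\<dots> = measure lebesgue (box (a + c) (b + d))"
    using ab cd by (subst m) (auto simp: inner_add_left intro!: prod.cong add_strict_mono)
  also have "\<dots> \<le> measure lebesgue (set_sum (box a b) (box c d))"
    using set_sum_box_superset[of a b c d] ab cd
    by (intro measure_mono_fmeasurable lmeasurable_open open_set_sum bounded_set_sum) auto
  finally show ?thesis .
qed

section \<open>Cuts by coordinate hyperplanes and the induction on families of boxes\<close>

lemma measure_split_hyperplane:
  fixes A :: "'a::euclidean_space set"
  assumes A: "A \<in> lmeasurable" and i: "i \<in> Basis"
  shows "measure lebesgue A = measure lebesgue (A \<inter> {x. x \<bullet> i < c}) + measure lebesgue (A \<inter> {x. c < x \<bullet> i})"
proof -
  have H: "{x. x \<bullet> i < c} \<in> sets lebesgue" "{x. c < x \<bullet> i} \<in> sets lebesgue"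
    by (auto intro!: borel_open open_Collect_less continuous_intros)
  have m: "A \<inter> {x. x \<bullet> i < c} \<in> lmeasurable" "A \<inter> {x. c < x \<bullet> i} \<in> lmeasurable"
    using A H by (auto intro: fmeasurable.Int fmeasurable_Int_fmeasurable)
  have "measure lebesgue A = measure lebesgue ((A \<inter> {x. x \<bullet> i < c}) \<union> (A \<inter> {x. c < x \<bullet> i}))"
  proof (rule measure_negligible_symdiff)
    have "negligible {x. i \<bullet> x = c}" using i by (intro negligible_hyperplane) auto
    then show "negligible (A \<inter> {x. x \<bullet> i < c} \<union> A \<inter> {x. c < x \<bullet> i} - A \<union>
        (A - (A \<inter> {x. x \<bullet> i < c} \<union> A \<inter> {x. c < x \<bullet> i})))"
      by (rule negligible_subset) (auto simp: inner_commute)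
  qed (use m in auto)
  also have "\<dots> = measure lebesgue (A \<inter> {x. x \<bullet> i < c}) + measure lebesgue (A \<inter> {x. c < x \<bullet> i})"
  proof -
    have "(A \<inter> {x. x \<bullet> i < c}) \<inter> (A \<inter> {x. c < x \<bullet> i}) = {}" by auto
    then show ?thesis using measure_Un3[OF m] by simp
  qed
  finally show ?thesis .
qed

text \<open>Dominated convergence: the indicators converge off the hyperplane at height
  \<open>c\<close>, a null set.\<close>

lemma continuous_measure_halfspace:
  fixes A :: "'a::euclidean_space set"
  assumes A: "A \<in> lmeasurable" and i: "i \<in> Basis"
  shows "continuous_on UNIV (\<lambda>c. measure lebesgue (A \<inter> {x. x \<bullet> i < c}))"
proof (rule continuous_on_sequentiallyI)
  fix u :: "nat \<Rightarrow> real" and c assume u: "u \<longlonglongrightarrow> c"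
  have H: "{x. x \<bullet> i < c} \<in> sets lebesgue" for c
    by (auto intro!: borel_open open_Collect_less continuous_intros)
  have AH: "A \<inter> {x. x \<bullet> i < c} \<in> lmeasurable" for c
    using A H by (auto intro: fmeasurable_Int_fmeasurable)
  have "(\<lambda>n. \<integral>x. indicat_real (A \<inter> {x. x \<bullet> i < u n}) x \<partial>lebesgue) \<longlonglongrightarrow> (\<integral>x. indicat_real (A \<inter> {x. x \<bullet> i < c}) x \<partial>lebesgue)"
  proof (rule integral_dominated_convergence[where w = "indicat_real A"])
    have "negligible {x. i \<bullet> x = c}" using i by (intro negligible_hyperplane) auto
    then have "AE x in lebesgue. x \<notin> {x. i \<bullet> x = c}"
      by (intro AE_not_in) (simp add: negligible_iff_null_sets)
    then show "AE x in lebesgue. (\<lambda>n. indicat_real (A \<inter> {x. x \<bullet> i < u n}) x) \<longlonglongrightarrow> indicat_real (A \<inter> {x. x \<bullet> i < c}) x"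
    proof eventually_elim
      case (elim x)
      then consider "x \<bullet> i < c" | "c < x \<bullet> i" by (auto simp: inner_commute) (meson linorder_neqE)
      then have "eventually (\<lambda>n. (x \<bullet> i < u n) = (x \<bullet> i < c)) sequentially"
      proof cases
        case 1
        with order_tendstoD(1)[OF u this] show ?thesis by (auto elim: eventually_mono)
      next
        case 2
        with order_tendstoD(2)[OF u this] show ?thesis by (auto elim!: eventually_mono)
      qed
      then show ?case
        by (intro tendsto_eventually) (auto elim!: eventually_mono simp: indicator_def)
    qed
    show "indicat_real (A \<inter> {x. x \<bullet> i < c}) \<in> borel_measurable lebesgue"
      "indicat_real (A \<inter> {x. x \<bullet> i < u n}) \<in> borel_measurable lebesgue" for n
      by (intro borel_measurable_indicator fmeasurableD AH)+
    show "integrable lebesgue (indicat_real A)" using A by (simp add: lmeasurable_iff_integrable)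
  qed (auto simp: indicator_def)
  then show "(\<lambda>n. measure lebesgue (A \<inter> {x. x \<bullet> i < u n})) \<longlonglongrightarrow> measure lebesgue (A \<inter> {x. x \<bullet> i < c})"
    using AH by (simp add: fmeasurableD)
qed

lemma ex_halfspace_measure:
  fixes A :: "'a::euclidean_space set"
  assumes A: "A \<in> lmeasurable" "bounded A" and i: "i \<in> Basis" and t: "0 \<le> t" "t \<le> measure lebesgue A"
  obtains c where "measure lebesgue (A \<inter> {x. x \<bullet> i < c}) = t"
proof -
  obtain M where M: "\<And>x. x \<in> A \<Longrightarrow> norm x \<le> M" using A(2) bounded_iff by metis
  have M: "- M \<le> x \<bullet> i \<and> x \<bullet> i \<le> M" if "x \<in> A" for x
    using M[OF that] Basis_le_norm[OF i, of x] by (auto simp: abs_le_iff)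
  have "A \<inter> {x. x \<bullet> i < - \<bar>M\<bar>} = {}" "A \<inter> {x. x \<bullet> i < \<bar>M\<bar> + 1} = A" using M by fastforce+
  then have "\<exists>c\<ge>- \<bar>M\<bar>. c \<le> \<bar>M\<bar> + 1 \<and> measure lebesgue (A \<inter> {x. x \<bullet> i < c}) = t"
    using t continuous_on_subset[OF continuous_measure_halfspace[OF A(1) i]]
    by (intro IVT') auto
  then show thesis using that by auto
qed

text \<open>Open boxes stay open boxes when cut by an open halfspace. Excluding the empty set gives
  every member positive volume and makes the cardinality a usable induction measure.\<close>

definition box_family :: "'a::euclidean_space set set \<Rightarrow> bool" where
  "box_family \<A> \<longleftrightarrow> finite \<A> \<and> pairwise disjnt \<A> \<and> (\<forall>D\<in>\<A>. D \<noteq> {} \<and> (\<exists>a b. D = box a b))"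

lemma box_family_open: "box_family \<A> \<Longrightarrow> open (\<Union>\<A>)"
  by (metis box_family_def open_Union open_box)

lemma box_family_bounded: "box_family \<A> \<Longrightarrow> bounded (\<Union>\<A>)"
  by (metis box_family_def bounded_Union bounded_box)

text \<open>The strict decrease when a box is missed drives the induction. \<open>H\<close> is
  abstract so that both kinds of open halfspace are served.\<close>

lemma box_family_cut:
  assumes A: "box_family \<A>" and H: "\<And>a b. \<exists>a' b'. box a b \<inter> H = box a' b'"
  defines "\<B> \<equiv> (\<lambda>D. D \<inter> H) ` \<A> - {{}}"
  shows "box_family \<B>" and "\<Union>\<B> = \<Union>\<A> \<inter> H" and "card \<B> \<le> card \<A>"
    and "D \<in> \<A> \<Longrightarrow> D \<inter> H = {} \<Longrightarrow> card \<B> < card \<A>"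
proof -
  have fin: "finite \<A>" using A by (simp add: box_family_def)
  show "box_family \<B>"
    unfolding box_family_def
  proof (intro conjI ballI)
    show "pairwise disjnt \<B>"
      using A unfolding box_family_def \<B>_def pairwise_def disjnt_def by blast
    fix D assume "D \<in> \<B>"
    then show "D \<noteq> {}" "\<exists>a b. D = box a b"
      using A H unfolding box_family_def \<B>_def by auto
  qed (use fin in \<open>simp add: \<B>_def\<close>)
  show "\<Union>\<B> = \<Union>\<A> \<inter> H" by (auto simp: \<B>_def)
  show "card \<B> \<le> card \<A>"
    unfolding \<B>_def using fin by (meson card_image_le card_mono Diff_subset finite_imageI order_trans)
  assume D: "D \<in> \<A>" "D \<inter> H = {}"
  have "\<B> \<subseteq> (\<lambda>D. D \<inter> H) ` (\<A> - {D})" using D by (auto simp: \<B>_def)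
  then have "card \<B> \<le> card (\<A> - {D})"
    using fin by (meson card_image_le card_mono finite_Diff finite_imageI order_trans)
  also have "\<dots> < card \<A>" using D fin by (intro psubset_card_mono) auto
  finally show "card \<B> < card \<A>" .
qed

lemma box_Int_halfspace:
  fixes i :: "'a::euclidean_space"
  assumes i: "i \<in> Basis"
  shows "\<exists>a' b'. box a b \<inter> {x. x \<bullet> i < c} = box a' b'" and "\<exists>a' b'. box a b \<inter> {x. c < x \<bullet> i} = box a' b'"
proof -
  have "x \<in> box a (b + (min c (b \<bullet> i) - b \<bullet> i) *\<^sub>R i) \<longleftrightarrow> x \<in> box a b \<and> x \<bullet> i < c" for x
    unfolding mem_box using i by (auto simp: inner_add_left inner_Basis split: if_splits)
  then show "\<exists>a' b'. box a b \<inter> {x. x \<bullet> i < c} = box a' b'" by blast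
  have "x \<in> box (a + (max c (a \<bullet> i) - a \<bullet> i) *\<^sub>R i) b \<longleftrightarrow> x \<in> box a b \<and> c < x \<bullet> i" for x
    unfolding mem_box using i by (auto simp: inner_add_left inner_Basis split: if_splits)
  then show "\<exists>a' b'. box a b \<inter> {x. c < x \<bullet> i} = box a' b'" by blast
qed

text \<open>The induction step of Hadwiger and Ohmann: cut the first family by a coordinate hyperplane
  separating two of its boxes, and the second one by a parallel hyperplane in the same volume
  ratio.\<close>

lemma brunn_minkowski_cut:
  fixes \<A> \<B> :: "'a::euclidean_space set set"
  assumes A: "box_family \<A>" and B: "box_family \<B>" "\<B> \<noteq> {}"
    and DE: "D \<in> \<A>" "E \<in> \<A>" "D \<noteq> E"
    and IH: "\<And>\<A>' \<B>' :: 'a set set. box_family \<A>' \<Longrightarrow> box_family \<B>' \<Longrightarrow> \<A>' \<noteq> {} \<Longrightarrow> \<B>' \<noteq> {} \<Longrightarrow>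
        card \<A>' + card \<B>' < card \<A> + card \<B> \<Longrightarrow>
        bm_sum DIM('a) (measure lebesgue (\<Union>\<A>')) (measure lebesgue (\<Union>\<B>'))
          \<le> measure lebesgue (set_sum (\<Union>\<A>') (\<Union>\<B>'))"
  shows "bm_sum DIM('a) (measure lebesgue (\<Union>\<A>)) (measure lebesgue (\<Union>\<B>))
    \<le> measure lebesgue (set_sum (\<Union>\<A>) (\<Union>\<B>))"
proof -
  let ?m = "measure lebesgue :: 'a set \<Rightarrow> real"
  let ?lo = "\<lambda>i c. {x::'a. x \<bullet> i < c}" and ?up = "\<lambda>i c. {x::'a. c < x \<bullet> i}"
  have sep: "\<exists>i\<in>Basis. \<exists>c. \<exists>D\<in>\<A>. \<exists>E\<in>\<A>. D \<subseteq> ?lo i c \<and> E \<subseteq> ?up i c"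
  proof -
    obtain a b where D: "D = box a b" "D \<noteq> {}" using A DE unfolding box_family_def by blast
    obtain c d where E: "E = box c d" "E \<noteq> {}" using A DE unfolding box_family_def by blast
    have "box a b \<inter> box c d = {}"
      using A DE D E unfolding box_family_def pairwise_def disjnt_def by blast
    then obtain i where i: "i \<in> Basis" "b \<bullet> i \<le> a \<bullet> i \<or> d \<bullet> i \<le> c \<bullet> i \<or> b \<bullet> i \<le> c \<bullet> i \<or> d \<bullet> i \<le> a \<bullet> i"
      unfolding disjoint_interval by blast
    have "a \<bullet> i < b \<bullet> i" "c \<bullet> i < d \<bullet> i" using D E i by (auto simp: box_ne_empty)
    then consider "b \<bullet> i \<le> c \<bullet> i" | "d \<bullet> i \<le> a \<bullet> i" using i by linarith
    then show ?thesis
    proof cases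
      case 1
      have "D \<subseteq> ?lo i (b \<bullet> i)" "E \<subseteq> ?up i (b \<bullet> i)" using 1 i D E by (force simp: mem_box)+
      then show ?thesis using i DE by blast
    next
      case 2
      have "E \<subseteq> ?lo i (d \<bullet> i)" "D \<subseteq> ?up i (d \<bullet> i)" using 2 i D E by (force simp: mem_box)+
      then show ?thesis using i DE by blast
    qed
  qed
  then obtain i c D' E' where i: "i \<in> Basis" and D: "D' \<in> \<A>" "D' \<subseteq> ?lo i c" and E: "E' \<in> \<A>" "E' \<subseteq> ?up i c"
    by blast
  have ne: "D' \<noteq> {}" "E' \<noteq> {}" using A D E by (auto simp: box_family_def)
  have bnd: "bounded (\<Union>\<A>)" "bounded (\<Union>\<B>)" using A B box_family_bounded by auto
  have opn: "open (\<Union>\<A>)" "open (\<Union>\<B>)" using A B box_family_open by auto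
  have lm: "\<Union>\<A> \<in> lmeasurable" "\<Union>\<B> \<in> lmeasurable" using bnd opn lmeasurable_open by auto
  have pos: "0 < ?m U" if "open U" "bounded U" "U \<noteq> {}" for U
    using that by (metis open_not_negligible lmeasurable_open negligible_iff_measure measure_nonneg less_eq_real_def)
  have hs: "open (?lo i c)" "open (?up i c)" for c
    by (auto intro!: open_Collect_less continuous_intros)
  \<comment> \<open>Each side of the cut contains a whole box of the first family, so
    \<open>\<theta>\<close> lies strictly between 0 and 1; the intermediate value theorem then cuts
    the second family in the same ratio.\<close>
  define \<theta> where "\<theta> = ?m (\<Union>\<A> \<inter> ?lo i c) / ?m (\<Union>\<A>)"
  have "\<Union>\<A> \<noteq> {}" using ne D by blast
  then have Apos: "0 < ?m (\<Union>\<A>)" using opn bnd pos by auto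
  have "\<Union>\<B> \<noteq> {}" using B by (auto simp: box_family_def)
  then have Bpos: "0 < ?m (\<Union>\<B>)" using opn bnd pos by auto
  have lo: "0 < ?m (\<Union>\<A> \<inter> ?lo i c)"
    using opn bnd hs ne D by (intro pos) (auto intro: bounded_subset)
  have up: "0 < ?m (\<Union>\<A> \<inter> ?up i c)"
    using opn bnd hs ne E by (intro pos) (auto intro: bounded_subset)
  note splitA = measure_split_hyperplane[OF lm(1) i, of c]
  have \<theta>: "0 < \<theta>" "\<theta> < 1" using lo up Apos splitA by (auto simp: \<theta>_def)
  have Alo: "?m (\<Union>\<A> \<inter> ?lo i c) = \<theta> * ?m (\<Union>\<A>)" using Apos by (simp add: \<theta>_def)
  then have Aup: "?m (\<Union>\<A> \<inter> ?up i c) = (1 - \<theta>) * ?m (\<Union>\<A>)" using splitA by (simp add: algebra_simps)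
  obtain c' where Blo: "?m (\<Union>\<B> \<inter> ?lo i c') = \<theta> * ?m (\<Union>\<B>)"
    using ex_halfspace_measure[OF lm(2) bnd(2) i, of "\<theta> * ?m (\<Union>\<B>)"] \<theta> by (auto simp: mult_left_le_one_le)
  then have Bup: "?m (\<Union>\<B> \<inter> ?up i c') = (1 - \<theta>) * ?m (\<Union>\<B>)"
    using measure_split_hyperplane[OF lm(2) i, of c'] by (simp add: algebra_simps)
  \<comment> \<open>The box \<open>F\<close> on the far side of the cut is lost, so the total number
    of boxes drops even if no box of the second family is lost.\<close>
  have part: "bm_sum DIM('a) (?m (\<Union>\<A> \<inter> H)) (?m (\<Union>\<B> \<inter> H')) \<le> ?m (set_sum (\<Union>\<A> \<inter> H) (\<Union>\<B> \<inter> H'))"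
    if H: "\<And>a b. \<exists>a' b'. box a b \<inter> H = box a' b'" "\<And>a b. \<exists>a' b'. box a b \<inter> H' = box a' b'"
      and F: "F \<in> \<A>" "F \<inter> H = {}" and p: "0 < ?m (\<Union>\<A> \<inter> H)" "0 < ?m (\<Union>\<B> \<inter> H')" for H H' F
  proof -
    note cA = box_family_cut[OF A H(1)] and cB = box_family_cut[OF B(1) H(2)]
    show ?thesis
      unfolding cA(2)[symmetric] cB(2)[symmetric]
    proof (rule IH)
      show "(\<lambda>D. D \<inter> H) ` \<A> - {{}} \<noteq> {}" using p(1) unfolding cA(2)[symmetric] by (metis Union_empty measure_empty less_irrefl)
      show "(\<lambda>D. D \<inter> H') ` \<B> - {{}} \<noteq> {}" using p(2) unfolding cB(2)[symmetric] by (metis Union_empty measure_empty less_irrefl)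
    qed (use cA(1) cB(1) cA(4)[OF F] cB(3) in auto)
  qed
  let ?A1 = "\<Union>\<A> \<inter> ?lo i c" and ?A2 = "\<Union>\<A> \<inter> ?up i c" and ?B1 = "\<Union>\<B> \<inter> ?lo i c'" and ?B2 = "\<Union>\<B> \<inter> ?up i c'"
  have bm1: "bm_sum DIM('a) (?m ?A1) (?m ?B1) \<le> ?m (set_sum ?A1 ?B1)"
    by (rule part[OF box_Int_halfspace(1)[OF i] box_Int_halfspace(1)[OF i] E(1)])
       (use E lo Blo Bpos \<theta> in auto)
  have bm2: "bm_sum DIM('a) (?m ?A2) (?m ?B2) \<le> ?m (set_sum ?A2 ?B2)"
    by (rule part[OF box_Int_halfspace(2)[OF i] box_Int_halfspace(2)[OF i] D(1)])
       (use D up Bup Bpos \<theta> in auto)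
  have lms: "set_sum X Y \<in> lmeasurable" if "open X" "bounded X" "bounded Y" for X Y :: "'a set"
    using that by (intro lmeasurable_open open_set_sum bounded_set_sum)
  have lm1: "set_sum ?A1 ?B1 \<in> lmeasurable" and lm2: "set_sum ?A2 ?B2 \<in> lmeasurable"
    using opn bnd hs by (auto intro!: lms intro: bounded_subset)
  \<comment> \<open>Heights add: one sum lies below \<open>c + c'\<close> and the other above, so
    their volumes add.\<close>
  have disj: "set_sum ?A1 ?B1 \<inter> set_sum ?A2 ?B2 = {}"
  proof -
    have "x \<bullet> i < c + c'" if "x \<in> set_sum ?A1 ?B1" for x
      using that by (auto simp: mem_set_sum inner_add_left)
    moreover have "c + c' < x \<bullet> i" if "x \<in> set_sum ?A2 ?B2" for x
      using that by (auto simp: mem_set_sum inner_add_left)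
    ultimately show ?thesis by (meson disjoint_iff less_asym)
  qed
  have "bm_sum DIM('a) (?m (\<Union>\<A>)) (?m (\<Union>\<B>))
      = \<theta> * bm_sum DIM('a) (?m (\<Union>\<A>)) (?m (\<Union>\<B>)) + (1 - \<theta>) * bm_sum DIM('a) (?m (\<Union>\<A>)) (?m (\<Union>\<B>))"
    by (simp add: algebra_simps)
  also have "\<dots> = bm_sum DIM('a) (?m ?A1) (?m ?B1) + bm_sum DIM('a) (?m ?A2) (?m ?B2)"
    unfolding Alo Aup Blo Bup using \<theta> by (simp add: bm_sum_scale)
  also have "\<dots> \<le> ?m (set_sum ?A1 ?B1) + ?m (set_sum ?A2 ?B2)" using bm1 bm2 by simp
  also have "\<dots> = ?m (set_sum ?A1 ?B1 \<union> set_sum ?A2 ?B2)"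
    using lm1 lm2 disj by (simp add: measure_Un3)
  also have "\<dots> \<le> ?m (set_sum (\<Union>\<A>) (\<Union>\<B>))"
    using lm1 lm2 lms[OF opn(1) bnd] set_sum_mono[of ?A1 "\<Union>\<A>" ?B1 "\<Union>\<B>"] set_sum_mono[of ?A2 "\<Union>\<A>" ?B2 "\<Union>\<B>"]
    by (intro measure_mono_fmeasurable fmeasurableD fmeasurable.Un) auto
  finally show ?thesis .
qed

text \<open>Either one of the families has two boxes and can be cut, with the roles exchanged by
  commutativity if it is the second, or both are single boxes.\<close>

lemma brunn_minkowski_box_family:
  fixes \<A> \<B> :: "'a::euclidean_space set set"
  assumes "box_family \<A>" "box_family \<B>" "\<A> \<noteq> {}" "\<B> \<noteq> {}"
  shows "bm_sum DIM('a) (measure lebesgue (\<Union>\<A>)) (measure lebesgue (\<Union>\<B>))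
    \<le> measure lebesgue (set_sum (\<Union>\<A>) (\<Union>\<B>))"
  using assms
proof (induction "card \<A> + card \<B>" arbitrary: \<A> \<B> rule: less_induct)
  case less
  obtain D0 E0 where D0: "D0 \<in> \<A>" "E0 \<in> \<B>" using less.prems(3,4) by blast
  have "\<A> = {D0}" if "\<not> (\<exists>D\<in>\<A>. \<exists>E\<in>\<A>. D \<noteq> E)" using that D0(1) by blast
  moreover have "\<B> = {E0}" if "\<not> (\<exists>D\<in>\<B>. \<exists>E\<in>\<B>. D \<noteq> E)" using that D0(2) by blast
  ultimately consider D E where "D \<in> \<A>" "E \<in> \<A>" "D \<noteq> E" | D E where "D \<in> \<B>" "E \<in> \<B>" "D \<noteq> E"
    | "\<A> = {D0}" "\<B> = {E0}"
    by metis
  then show ?case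
  proof cases
    case 1
    show ?thesis
      by (rule brunn_minkowski_cut[OF less.prems(1,2,4) 1]) (rule less.hyps)
  next
    case 2
    have "bm_sum DIM('a) (measure lebesgue (\<Union>\<B>)) (measure lebesgue (\<Union>\<A>))
        \<le> measure lebesgue (set_sum (\<Union>\<B>) (\<Union>\<A>))"
      by (rule brunn_minkowski_cut[OF less.prems(2,1,3) 2]) (rule less.hyps, auto)
    then show ?thesis by (simp add: bm_sum_commute set_sum_commute)
  next
    case 3
    obtain a b where ab: "D0 = box a b" "D0 \<noteq> {}"
      using less.prems(1) D0(1) unfolding box_family_def by blast
    obtain c d where cd: "E0 = box c d" "E0 \<noteq> {}"
      using less.prems(2) D0(2) unfolding box_family_def by blast
    show ?thesis using brunn_minkowski_box[of a b c d] 3 ab cd by simp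
  qed
qed

text \<open>An open set is a countable union of closed boxes. Each finite partial union is
  subdivided into boxes with disjoint interiors, and passing to interiors loses only a null
  set.\<close>

lemma open_box_family_approx:
  fixes U :: "'a::euclidean_space set"
  assumes U: "open U" "bounded U"
  obtains \<A> where "\<And>n. box_family (\<A> n)" "\<And>n. \<Union>(\<A> n) \<subseteq> U"
    "(\<lambda>n. measure lebesgue (\<Union>(\<A> n))) \<longlonglongrightarrow> measure lebesgue U"
proof -
  obtain \<D> where D: "countable \<D>" "\<D> \<subseteq> Pow U" "\<And>X. X \<in> \<D> \<Longrightarrow> \<exists>a b. X = cbox a b" "\<Union>\<D> = U"
    using open_countable_Union_open_cbox[OF U(1)] by metis
  define C where "C n = insert {} {X \<in> \<D>. to_nat_on \<D> X \<le> n}" for n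
  have finC: "finite (C n)" for n
  proof -
    have "inj_on (to_nat_on \<D>) {X \<in> \<D>. to_nat_on \<D> X \<le> n}"
      by (rule inj_on_subset[OF inj_on_to_nat_on[OF D(1)]]) auto
    moreover have "to_nat_on \<D> ` {X \<in> \<D>. to_nat_on \<D> X \<le> n} \<subseteq> {..n}" by auto
    ultimately show ?thesis unfolding C_def by (meson finite_atMost finite_imageD finite_insert finite_subset)
  qed
  have lim: "(\<lambda>n. measure lebesgue (\<Union>(C n))) \<longlonglongrightarrow> measure lebesgue (\<Union>n. \<Union>(C n))"
  proof (rule Lim_measure_incseq)
    have "\<Union>(C n) \<in> sets lebesgue" for n
      using finC[of n] D(3) by (intro sets.finite_Union) (auto simp: C_def dest!: D(3))
    then show "range (\<lambda>n. \<Union>(C n)) \<subseteq> sets lebesgue" by auto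
    show "incseq (\<lambda>n. \<Union>(C n))" by (rule incseq_SucI) (auto simp: C_def intro: le_SucI)
    have "(\<Union>n. \<Union>(C n)) = U" using D(4) by (auto simp: C_def)
    then show "emeasure lebesgue (\<Union>n. \<Union>(C n)) \<noteq> \<infinity>"
      using fmeasurableD2[OF lmeasurable_open[OF U(2,1)]] by simp
  qed
  have UC: "(\<Union>n. \<Union>(C n)) = U" using D(4) by (auto simp: C_def)
  have "\<exists>\<A>. box_family \<A> \<and> \<Union>\<A> \<subseteq> U \<and> measure lebesgue (\<Union>\<A>) = measure lebesgue (\<Union>(C n))" for n
  proof -
    have cb: "\<exists>a b. X = cbox a b" if "X \<in> C n" for X
      using that D(3) by (auto simp: C_def) (metis box_eq_empty(2) empty_as_interval)
    obtain p where p: "p division_of (\<Union>(C n))"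
      using elementary_unions_intervals[OF finC cb] by blast
    \<comment> \<open>Degenerate pieces are dropped: they have volume zero, and their empty
      interiors are not allowed in a box family.\<close>
    define q where "q = {k \<in> p. interior k \<noteq> {}}"
    have fin: "finite p" using p by blast
    have kb: "\<exists>a b. k = cbox a b \<and> interior k = box a b" if "k \<in> p" for k
    proof -
      obtain a b where "k = cbox a b" using division_ofD(4)[OF p \<open>k \<in> p\<close>] by blast
      then show ?thesis by (intro exI[of _ a] exI[of _ b]) simp
    qed
    have disj: "pairwise (\<lambda>j k. disjnt (interior j) (interior k)) p"
      using division_ofD(5)[OF p] by (simp add: pairwise_def disjnt_def)
    have "box_family (interior ` q)"
      unfolding box_family_def
    proof (intro conjI)
      show "pairwise disjnt (interior ` q)"
        using disj by (auto simp: q_def pairwise_def)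
    qed (use fin kb in \<open>auto simp: q_def\<close>)
    moreover have "\<Union>(interior ` q) \<subseteq> U"
    proof -
      have "interior k \<subseteq> U" if "k \<in> p" for k
        using division_ofD(2)[OF p that] interior_subset[of k] UC by blast
      then show ?thesis unfolding q_def by blast
    qed
    moreover have "measure lebesgue (\<Union>(interior ` q)) = measure lebesgue (\<Union>(C n))"
    proof -
      have eq: "measure lebesgue (interior k) = measure lebesgue k" if "k \<in> p" for k
        using kb[OF that] by (auto simp: measure_completion measure_lborel_box_eq measure_lborel_cbox_eq)
      have "measure lebesgue (\<Union>(interior ` q)) = (\<Sum>k\<in>q. measure lebesgue (interior k))"
      proof (rule measure_UNION')
        fix k assume "k \<in> q"
        then obtain a b where "interior k = box a b" using kb[of k] by (auto simp: q_def)
        then show "interior k \<in> lmeasurable" by simp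
      qed (use fin disj in \<open>auto simp: q_def pairwise_def\<close>)
      also have "\<dots> = (\<Sum>k\<in>p. measure lebesgue (interior k))"
        using fin by (intro sum.mono_neutral_left) (auto simp: q_def)
      also have "\<dots> = measure lebesgue (\<Union>(C n))"
        using content_division[OF p] eq by simp
      finally show ?thesis .
    qed
    ultimately show ?thesis by blast
  qed
  then obtain \<A> where "\<And>n. box_family (\<A> n) \<and> \<Union>(\<A> n) \<subseteq> U \<and> measure lebesgue (\<Union>(\<A> n)) = measure lebesgue (\<Union>(C n))"
    by metis
  then show thesis using lim[unfolded UC] by (intro that[of \<A>]) auto
qed

lemma brunn_minkowski_open:
  fixes U W :: "'a::euclidean_space set"
  assumes U: "open U" "bounded U" "U \<noteq> {}" and W: "open W" "bounded W" "W \<noteq> {}"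
  shows "bm_sum DIM('a) (measure lebesgue U) (measure lebesgue W) \<le> measure lebesgue (set_sum U W)"
proof -
  obtain \<A> where A: "\<And>n. box_family (\<A> n)" "\<And>n. \<Union>(\<A> n) \<subseteq> U"
    "(\<lambda>n. measure lebesgue (\<Union>(\<A> n))) \<longlonglongrightarrow> measure lebesgue U"
    using open_box_family_approx[OF U(1,2)] by metis
  obtain \<B> where B: "\<And>n. box_family (\<B> n)" "\<And>n. \<Union>(\<B> n) \<subseteq> W"
    "(\<lambda>n. measure lebesgue (\<Union>(\<B> n))) \<longlonglongrightarrow> measure lebesgue W"
    using open_box_family_approx[OF W(1,2)] by metis
  have pos: "0 < measure lebesgue X" if "open X" "bounded X" "X \<noteq> {}" for X :: "'a set"
    using that by (metis open_not_negligible lmeasurable_open negligible_iff_measure measure_nonneg less_eq_real_def)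
  have "(\<lambda>n. bm_sum DIM('a) (measure lebesgue (\<Union>(\<A> n))) (measure lebesgue (\<Union>(\<B> n))))
    \<longlonglongrightarrow> bm_sum DIM('a) (measure lebesgue U) (measure lebesgue W)"
    unfolding bm_sum_def by (intro tendsto_intros A B)
  \<comment> \<open>Positivity of the limit volumes makes the approximating families eventually
    nonempty.\<close>
  moreover have "eventually (\<lambda>n. bm_sum DIM('a) (measure lebesgue (\<Union>(\<A> n))) (measure lebesgue (\<Union>(\<B> n)))
    \<le> measure lebesgue (set_sum U W)) sequentially"
    using order_tendstoD(1)[OF A(3) pos[OF U]] order_tendstoD(1)[OF B(3) pos[OF W]]
  proof eventually_elim
    case (elim n)
    have "bm_sum DIM('a) (measure lebesgue (\<Union>(\<A> n))) (measure lebesgue (\<Union>(\<B> n)))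
      \<le> measure lebesgue (set_sum (\<Union>(\<A> n)) (\<Union>(\<B> n)))"
      using elim by (intro brunn_minkowski_box_family A B) auto
    also have "\<dots> \<le> measure lebesgue (set_sum U W)"
      using A B U W set_sum_mono[OF A(2) B(2)]
      by (intro measure_mono_fmeasurable fmeasurableD lmeasurable_open open_set_sum bounded_set_sum box_family_open box_family_bounded)
    finally show ?case .
  qed
  ultimately show ?thesis by (intro tendsto_upperbound) auto
qed

section \<open>Minkowski's first inequality\<close>

text \<open>Bernoulli's inequality for \<open>y / x\<close>, scaled by \<open>x ^ n\<close>.\<close>

lemma power_add_ge_first_order:
  fixes x y :: real
  assumes "0 < x" "0 \<le> y"
  shows "x ^ n + real n * x ^ (n - 1) * y \<le> (x + y) ^ n"
proof (cases n)
  case (Suc j)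
  have "x ^ n + real n * x ^ (n - 1) * y = x ^ n * (1 + real n * (y / x))"
    using assms Suc by (simp add: field_simps)
  also have "\<dots> \<le> x ^ n * (1 + y / x) ^ n"
    using assms by (intro mult_left_mono Bernoulli_inequality) (auto intro: order_trans[of _ 0])
  also have "\<dots> = (x + y) ^ n"
    using assms by (simp add: field_simps flip: power_mult_distrib)
  finally show ?thesis .
qed simp

lemma measure_convex_interior_pos:
  fixes K :: "'a::euclidean_space set"
  assumes "bounded K" "convex K" "interior K \<noteq> {}"
  shows "0 < measure lebesgue K"
proof -
  have "\<not> negligible (interior K)" using assms open_not_negligible by auto
  then have "0 < measure lebesgue (interior K)"
    using assms lmeasurable_interior negligible_iff_measure measure_nonneg less_eq_real_def by metis
  then show ?thesis
    using measure_interior[OF assms(1) negligible_convex_frontier[OF assms(2)]] by linarith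
qed

text \<open>Brunn-Minkowski for the interiors of \<open>K\<close> and \<open>e L\<close>, keeping
  the first two binomial terms. For \<open>L\<close> of volume zero the linear term vanishes, and
  \<open>K \<subseteq> K + e L\<close> suffices because \<open>0 \<in> L\<close>.\<close>

lemma brunn_minkowski_first_order:
  fixes K L :: "'a::euclidean_space set"
  assumes K: "compact K" "convex K" "interior K \<noteq> {}" and L: "compact L" "convex L" "0 \<in> L" and e: "0 < e"
  shows "measure lebesgue K + e * (real DIM('a) * root DIM('a) (measure lebesgue K) ^ (DIM('a) - 1) * root DIM('a) (measure lebesgue L))
    \<le> measure lebesgue ((\<lambda>(y, z). y + e *\<^sub>R z) ` (K \<times> L))" (is "_ \<le> measure lebesgue ?KL")
proof -
  have "compact ((\<lambda>p. fst p + e *\<^sub>R snd p) ` (K \<times> L))"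
    using K(1) L(1) by (intro compact_continuous_image compact_Times continuous_intros)
  then have KLm: "?KL \<in> lmeasurable" by (simp add: case_prod_beta' lmeasurable_compact)
  show ?thesis
  proof (cases "measure lebesgue L = 0")
    case True
    have "K \<subseteq> ?KL" using L(3) by force
    then have "measure lebesgue K \<le> measure lebesgue ?KL"
      using KLm K(1) by (intro measure_mono_fmeasurable) (auto intro: fmeasurableD lmeasurable_compact)
    then show ?thesis using True by simp
  next
    case False
    let ?W = "(\<lambda>x. e *\<^sub>R x + 0) ` interior L"
    have mL: "measure lebesgue (interior L) = measure lebesgue L"
      using L compact_imp_bounded by (intro measure_interior negligible_convex_frontier) auto
    then have neL: "interior L \<noteq> {}" using False by auto
    have mK: "measure lebesgue (interior K) = measure lebesgue K"
      using K compact_imp_bounded by (intro measure_interior negligible_convex_frontier) auto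
    have Kpos: "0 < measure lebesgue K"
      using K compact_imp_bounded by (intro measure_convex_interior_pos) auto
    have mW: "measure lebesgue ?W = e ^ DIM('a) * measure lebesgue L"
      unfolding measure_lebesgue_affine using e mL by simp
    have W: "open ?W" "bounded ?W"
      using e open_scaling[of e "interior L"] bounded_scaling[of "interior L" e] L(1) compact_imp_bounded bounded_interior
      by auto
    have "bm_sum DIM('a) (measure lebesgue (interior K)) (measure lebesgue ?W) \<le> measure lebesgue (set_sum (interior K) ?W)"
      using W K neL compact_imp_bounded bounded_interior by (intro brunn_minkowski_open) auto
    also have "\<dots> \<le> measure lebesgue ?KL"
    proof (rule measure_mono_fmeasurable)
      show "set_sum (interior K) ?W \<subseteq> ?KL"
        using interior_subset by (fastforce simp: mem_set_sum)
      show "set_sum (interior K) ?W \<in> sets lebesgue"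
        by (intro sets_completionI_sets) (auto intro: borel_open open_set_sum)
    qed (rule KLm)
    finally have "(root DIM('a) (measure lebesgue K) + e * root DIM('a) (measure lebesgue L)) ^ DIM('a) \<le> measure lebesgue ?KL"
      using e by (simp only: bm_sum_def mK mW) (simp add: real_root_mult real_root_power_cancel)
    moreover have "root DIM('a) (measure lebesgue K) ^ DIM('a)
        + real DIM('a) * root DIM('a) (measure lebesgue K) ^ (DIM('a) - 1) * (e * root DIM('a) (measure lebesgue L))
      \<le> (root DIM('a) (measure lebesgue K) + e * root DIM('a) (measure lebesgue L)) ^ DIM('a)"
      using Kpos e by (intro power_add_ge_first_order) auto
    ultimately show ?thesis using Kpos by (simp add: mult_ac)
  qed
qed

text \<open>The difference is null, so its open part \<open>interior B - A\<close> is empty, and a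
  convex set with interior points lies in the closure of its interior.\<close>

lemma subset_if_measure_le:
  fixes A B :: "'a::euclidean_space set"
  assumes A: "closed A" "A \<subseteq> B" and B: "bounded B" "convex B" "interior B \<noteq> {}"
    and le: "measure lebesgue B \<le> measure lebesgue A"
  shows "B \<subseteq> A"
proof -
  have Bm: "B \<in> lmeasurable" using B by (intro measurable_convex)
  have Am: "A \<in> lmeasurable"
    using A B by (intro lmeasurable_compact) (auto simp: compact_eq_bounded_closed intro: bounded_subset)
  have "measure lebesgue (B - A) = 0"
    using measurable_measure_Diff[OF Bm fmeasurableD[OF Am] A(2)] le measure_nonneg[of lebesgue "B - A"] by linarith
  then have "negligible (B - A)"
    using Am Bm by (subst negligible_iff_measure) (auto intro: fmeasurable.Diff fmeasurableD)
  then have "negligible (interior B - A)"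
    by (rule negligible_subset) (use interior_subset in auto)
  then have "interior B \<subseteq> A"
    using A(1) open_not_negligible[of "interior B - A"] by (auto simp: open_Diff)
  then have "closure (interior B) \<subseteq> A" using A(1) by (rule closure_minimal)
  then show ?thesis using convex_closure_interior[OF B(2,3)] closure_subset by blast
qed

context
  fixes K :: "'a::euclidean_space set"
  assumes K: "compact K" "convex K" "interior K \<noteq> {}"
begin

lemma minkowski_first_inequality:
  assumes L: "compact L" "convex L" "0 \<in> L"
  shows "real DIM('a) * root DIM('a) (measure lebesgue K) ^ (DIM('a) - 1) * root DIM('a) (measure lebesgue L)
    \<le> (\<integral>u. support_function L u \<partial>surface_area_measure K)"
proof -
  have "K \<noteq> {}" using K(3) by auto
  then show ?thesis
    by (rule le_integral_support_function[OF K(1,2) _ L(1,3)]) (rule brunn_minkowski_first_order[OF K L])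
qed

lemma integral_support_function_self:
  assumes 0: "0 \<in> K"
  shows "(\<integral>u. support_function K u \<partial>surface_area_measure K) = real DIM('a) * measure lebesgue K"
proof (rule antisym)
  have "root DIM('a) (measure lebesgue K) ^ (DIM('a) - 1) * root DIM('a) (measure lebesgue K) = measure lebesgue K"
    by (metis DIM_positive measure_nonneg power_minus_mult real_root_pow_pos2)
  then show "real DIM('a) * measure lebesgue K \<le> (\<integral>u. support_function K u \<partial>surface_area_measure K)"
    using minkowski_first_inequality[OF K(1,2) 0] by (simp add: mult.assoc)
  show "(\<integral>u. support_function K u \<partial>surface_area_measure K) \<le> real DIM('a) * measure lebesgue K"
    using K 0 by (intro integral_support_function_self_le) auto
qed

lemma integrable_support_function:
  assumes L: "bounded L" "L \<noteq> {}"
  shows "integrable (surface_area_measure K) (support_function L)"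
proof -
  have Kne: "K \<noteq> {}" using K(3) by auto
  interpret finite_measure "surface_area_measure K"
    by (rule finite_measure_surface_area_measure[OF K(1,2) Kne])
  have "compact (support_function L ` sphere 0 1)"
    by (intro compact_continuous_image continuous_on_support_function[OF L] compact_sphere)
  then obtain B where "\<And>u. u \<in> sphere 0 1 \<Longrightarrow> norm (support_function L u) \<le> B"
    using compact_imp_bounded bounded_iff by (metis image_eqI)
  then show ?thesis
    using support_function_measurable_surface[OF K(1,2) Kne L]
    by (intro integrable_const_bound[where B = B] AE_I2) (auto simp: space_surface_area_measure[OF K(1,2) Kne])
qed

text \<open>Adjoining \<open>r L\<close> to \<open>K\<close> does not change the support function almost everywhere, so by
  Minkowski's inequality it does not change the volume either.\<close>

lemma scaled_subset_if_AE_support_function_le: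
  assumes 0: "0 \<in> K" and L: "compact L" "convex L" and r: "0 \<le> r"
    and AE: "AE u in surface_area_measure K. r * support_function L u \<le> support_function K u"
  shows "(\<lambda>x. r *\<^sub>R x) ` L \<subseteq> K"
proof -
  let ?S = "surface_area_measure K" and ?n = "DIM('a)"
  define M where "M = convex hull (K \<union> (\<lambda>x. r *\<^sub>R x) ` L)"
  have M: "compact M" "convex M" "K \<subseteq> M" "(\<lambda>x. r *\<^sub>R x) ` L \<subseteq> M"
    using K(1) L(1) hull_subset[of "K \<union> (\<lambda>x. r *\<^sub>R x) ` L" convex]
    by (auto simp: M_def intro!: compact_convex_hull compact_Un compact_scaling)
  have M0: "0 \<in> M" "M \<noteq> {}" using M(3) 0 by auto
  have bd: "bounded K" "K \<noteq> {}" "bounded L" using K L(1) compact_imp_bounded by auto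
  have "AE u in ?S. support_function M u \<le> support_function K u"
    using AE
  proof eventually_elim
    case (elim u)
    have "M \<subseteq> {z. u \<bullet> z \<le> support_function K u}"
      unfolding M_def
    proof (rule hull_minimal)
      have "u \<bullet> (r *\<^sub>R y) \<le> support_function K u" if "y \<in> L" for y
        using mult_left_mono[OF support_function_ge[OF bd(3) that, of u] r] elim by simp
      then show "K \<union> (\<lambda>x. r *\<^sub>R x) ` L \<subseteq> {z. u \<bullet> z \<le> support_function K u}"
        using support_function_ge[OF bd(1)] by auto
    qed (rule convex_halfspace_le)
    then show ?case using M0(2) by (intro support_function_le) auto
  qed
  then have "(\<integral>u. support_function M u \<partial>?S) \<le> (\<integral>u. support_function K u \<partial>?S)"
    using M(1) M0 bd compact_imp_bounded by (intro integral_mono_AE integrable_support_function) auto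
  also have "\<dots> = real ?n * measure lebesgue K" by (rule integral_support_function_self[OF 0])
  finally have le: "real ?n * root ?n (measure lebesgue K) ^ (?n - 1) * root ?n (measure lebesgue M) \<le> real ?n * measure lebesgue K"
    using minkowski_first_inequality[OF M(1,2) M0(1)] by linarith
  have Kpos: "0 < measure lebesgue K" using K bd by (intro measure_convex_interior_pos)
  have "measure lebesgue K = root ?n (measure lebesgue K) ^ (?n - 1) * root ?n (measure lebesgue K)"
    by (metis DIM_positive measure_nonneg power_minus_mult real_root_pow_pos2)
  with le have "real ?n * root ?n (measure lebesgue K) ^ (?n - 1) * root ?n (measure lebesgue M)
      \<le> real ?n * root ?n (measure lebesgue K) ^ (?n - 1) * root ?n (measure lebesgue K)"
    by (simp only: mult.assoc)
  then have "root ?n (measure lebesgue M) \<le> root ?n (measure lebesgue K)"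
    by (rule mult_left_le_imp_le) (use Kpos in auto)
  then have "measure lebesgue M \<le> measure lebesgue K" by simp
  moreover have "interior M \<noteq> {}" using interior_mono[OF M(3)] K(3) by auto
  ultimately have "M \<subseteq> K"
    using subset_if_measure_le[OF compact_imp_closed[OF K(1)] M(3) compact_imp_bounded[OF M(1)] M(2)]
    by blast
  then show ?thesis using M(4) by blast
qed

end

section \<open>The logarithmic inequality\<close>

context
  fixes K L :: "'a::euclidean_space set"
  assumes K: "compact K" "convex K" "0 \<in> interior K"
    and L: "compact L" "convex L" "0 \<in> L" "L \<subseteq> interior K"
begin

lemma support_function_pos:
  assumes "u \<noteq> 0"
  shows "0 < support_function K u"
proof -
  obtain d where d: "d > 0" "cball 0 d \<subseteq> K" using K(3) by (auto simp: mem_interior_cball)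
  have "(d / norm u) *\<^sub>R u \<in> K" using d assms by (intro subsetD[OF d(2)]) simp
  then have "u \<bullet> ((d / norm u) *\<^sub>R u) \<le> support_function K u"
    using K(1) compact_imp_bounded by (intro support_function_ge) auto
  moreover have "0 < u \<bullet> ((d / norm u) *\<^sub>R u)" using d assms by simp
  ultimately show ?thesis by linarith
qed

text \<open>The maximum over \<open>L\<close> is attained at a point interior to \<open>K\<close>,
  from which one can still move in direction \<open>u\<close>.\<close>

lemma support_function_less:
  assumes "u \<noteq> 0"
  shows "support_function L u < support_function K u"
proof -
  have "compact ((\<bullet>) u ` L)" using L(1) by (intro compact_continuous_image continuous_intros)
  then have "\<exists>m\<in>(\<bullet>) u ` L. \<forall>t\<in>(\<bullet>) u ` L. t \<le> m"
    using L(3) by (intro compact_attains_sup) auto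
  then obtain y where y: "y \<in> L" "\<And>z. z \<in> L \<Longrightarrow> u \<bullet> z \<le> u \<bullet> y" by auto
  obtain d where d: "d > 0" "cball y d \<subseteq> K" using y L(4) by (auto simp: mem_interior_cball subset_eq)
  have "y + (d / norm u) *\<^sub>R u \<in> K" using d assms by (intro subsetD[OF d(2)]) (simp add: dist_norm)
  then have "u \<bullet> (y + (d / norm u) *\<^sub>R u) \<le> support_function K u"
    using K(1) compact_imp_bounded by (intro support_function_ge) auto
  moreover have "0 < u \<bullet> ((d / norm u) *\<^sub>R u)" using d assms by simp
  moreover have "support_function L u \<le> u \<bullet> y" using y by (intro support_function_le) auto
  ultimately show ?thesis by (simp add: inner_add_right)
qed

text \<open>Compactness of the sphere turns the pointwise strict inequality into a uniform gap below
  1, which keeps the logarithm bounded and hence integrable.\<close>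

lemma support_function_ratio_bound:
  obtains s where "s < 1" "\<And>u. u \<in> sphere 0 1 \<Longrightarrow> 0 \<le> support_function L u / support_function K u"
    "\<And>u. u \<in> sphere 0 1 \<Longrightarrow> support_function L u / support_function K u \<le> s"
proof -
  have bd: "bounded K" "K \<noteq> {}" "bounded L" "L \<noteq> {}" using K L compact_imp_bounded interior_subset by auto
  have pos: "0 < support_function K u" if "u \<in> sphere 0 1" for u
    using that by (intro support_function_pos) auto
  have "compact ((\<lambda>u. support_function L u / support_function K u) ` sphere 0 1)"
    by (intro compact_continuous_image continuous_on_divide continuous_on_support_function bd compact_sphere ballI)
       (use pos in force)
  then have "\<exists>m\<in>(\<lambda>u. support_function L u / support_function K u) ` sphere 0 1.
      \<forall>t\<in>(\<lambda>u. support_function L u / support_function K u) ` sphere 0 1. t \<le> m"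
    by (intro compact_attains_sup) auto
  then obtain v where v: "v \<in> sphere 0 1"
    "\<And>u. u \<in> sphere 0 1 \<Longrightarrow> support_function L u / support_function K u \<le> support_function L v / support_function K v"
    by auto
  have "support_function L v / support_function K v < 1"
    using v(1) support_function_less[of v] pos[of v] by (cases "v = 0") (auto simp: field_simps)
  moreover have "0 \<le> support_function L u / support_function K u" if "u \<in> sphere 0 1" for u
    using pos[OF that] support_function_ge[OF bd(3) L(3), of u] by simp
  ultimately show thesis using that v(2) by blast
qed

text \<open>The density is strictly positive on the sphere, so both measures have the same null
  sets; its integral is 1 because \<open>h_K\<close> integrates to \<open>n V(K)\<close>.\<close>

lemma
  assumes g: "g \<in> borel_measurable (surface_area_measure K)"
  shows integral_normalized_cone_measure:
    "(\<integral>u. g u \<partial>normalized_cone_measure K)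
      = (\<integral>u. support_function K u / (real DIM('a) * measure lebesgue K) * g u \<partial>surface_area_measure K)"
    and AE_normalized_cone_measure:
    "(AE u in normalized_cone_measure K. g u = c) \<longleftrightarrow> (AE u in surface_area_measure K. g u = c)"
    and measure_normalized_cone_measure: "emeasure (normalized_cone_measure K) (space (normalized_cone_measure K)) = 1"
proof -
  let ?S = "surface_area_measure K"
  have bd: "bounded K" "K \<noteq> {}" "interior K \<noteq> {}" using K compact_imp_bounded interior_subset by auto
  have Kpos: "0 < measure lebesgue K" using K bd by (intro measure_convex_interior_pos)
  have pos: "0 < support_function K u / (real DIM('a) * measure lebesgue K)" if "u \<in> space ?S" for u
    using that Kpos support_function_pos[of u]
    by (cases "u = 0") (auto simp: space_surface_area_measure[OF K(1,2) bd(2)])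
  have m: "(\<lambda>u. support_function K u / (real DIM('a) * measure lebesgue K)) \<in> borel_measurable ?S"
    using support_function_measurable_surface[OF K(1,2) bd(2,1,2)] by measurable
  have AEpos: "AE u in ?S. 0 \<le> support_function K u / (real DIM('a) * measure lebesgue K)"
    using pos by (intro AE_I2) (auto intro: less_imp_le)
  show "(\<integral>u. g u \<partial>normalized_cone_measure K)
      = (\<integral>u. support_function K u / (real DIM('a) * measure lebesgue K) * g u \<partial>?S)"
    unfolding normalized_cone_measure_def using integral_density[OF g m AEpos] by simp
  show "(AE u in normalized_cone_measure K. g u = c) \<longleftrightarrow> (AE u in ?S. g u = c)"
    unfolding normalized_cone_measure_def using m pos
    by (subst AE_density) (auto intro!: AE_cong simp: ennreal_eq_0_iff)
  have "emeasure (normalized_cone_measure K) (space (normalized_cone_measure K))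
    = (\<integral>\<^sup>+u. ennreal (support_function K u / (real DIM('a) * measure lebesgue K)) \<partial>?S)"
    unfolding normalized_cone_measure_def using m
    by (subst emeasure_density) (auto intro!: nn_integral_cong)
  also have "\<dots> = ennreal (\<integral>u. support_function K u / (real DIM('a) * measure lebesgue K) \<partial>?S)"
    using integrable_support_function[OF K(1,2) bd(3,1,2)] AEpos
    by (intro nn_integral_eq_integral) auto
  also have "(\<integral>u. support_function K u / (real DIM('a) * measure lebesgue K) \<partial>?S) = 1"
    using integral_support_function_self[OF K(1,2) bd(3) subsetD[OF interior_subset K(3)]] Kpos by simp
  finally show "emeasure (normalized_cone_measure K) (space (normalized_cone_measure K)) = 1" by simp
qed

lemma log_minkowski_inequality:
  defines "n \<equiv> DIM('a)"
  defines "m \<equiv> root n (measure lebesgue L) / root n (measure lebesgue K)"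
  defines "I \<equiv> \<integral>u. ln ((support_function K u - support_function L u) / support_function K u) \<partial>normalized_cone_measure K"
  shows "I \<le> ln (1 - m)"
    and "I = ln (1 - m) \<Longrightarrow> AE u in surface_area_measure K. support_function L u / support_function K u = m"
proof -
  let ?S = "surface_area_measure K" and ?P = "normalized_cone_measure K"
  let ?h = "support_function K" and ?V = "measure lebesgue K"
  have bd: "bounded K" "K \<noteq> {}" "interior K \<noteq> {}" "bounded L" "L \<noteq> {}"
    using K L compact_imp_bounded interior_subset by auto
  have Kpos: "0 < ?V" using K bd by (intro measure_convex_interior_pos)
  have n: "0 < n" by (simp add: n_def)
  have spS: "space ?S = sphere 0 1" by (rule space_surface_area_measure[OF K(1,2) bd(2)])
  have spP: "space ?P = sphere 0 1" and setsP: "sets ?P = sets ?S"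
    by (simp_all add: normalized_cone_measure_def spS)
  have mK [measurable]: "?h \<in> borel_measurable ?S" and mL [measurable]: "support_function L \<in> borel_measurable ?S"
    using support_function_measurable_surface[OF K(1,2) bd(2)] bd by auto
  define t where "t u = support_function L u / ?h u" for u
  have mt: "t \<in> borel_measurable ?S" unfolding t_def by measurable
  have mtP [measurable]: "t \<in> borel_measurable ?P" using mt measurable_cong_sets[OF setsP refl] by blast
  have hpos: "0 < ?h u" if "u \<in> sphere 0 1" for u using that by (intro support_function_pos) auto
  obtain s where s: "s < 1" and t: "\<And>u. u \<in> sphere 0 1 \<Longrightarrow> 0 \<le> t u \<and> t u \<le> s"
    unfolding t_def using support_function_ratio_bound by metis
  interpret P: finite_measure ?P
    by standard (simp add: measure_normalized_cone_measure[OF mt])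
  have P1: "measure ?P (space ?P) = 1"
    by (simp add: measure_def measure_normalized_cone_measure[OF mt])
  have it: "integrable ?P t"
    using t by (intro P.integrable_const_bound[where B = s] AE_I2) (auto simp: spP)
  define f where "f u = ln (1 - t u)" for u
  have I: "I = (\<integral>u. f u \<partial>?P)"
    unfolding I_def
  proof (rule Bochner_Integration.integral_cong[OF refl])
    fix u assume "u \<in> space ?P"
    then show "ln ((?h u - support_function L u) / ?h u) = f u"
      using hpos[of u] by (simp add: spP f_def t_def diff_divide_distrib)
  qed
  have "\<bar>f u\<bar> \<le> - ln (1 - s)" if "u \<in> sphere 0 1" for u
    using t[OF that] s ln_mono[of "1 - s" "1 - t u"] ln_le_zero_iff[of "1 - t u"] by (simp add: f_def)
  moreover have "f \<in> borel_measurable ?P" unfolding f_def by measurable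
  ultimately have if': "integrable ?P f"
    by (intro P.integrable_const_bound[where B = "- ln (1 - s)"] AE_I2) (auto simp: spP)
  define T where "T = (\<integral>u. t u \<partial>?P)"
  have "T \<le> (\<integral>u. s \<partial>?P)"
    unfolding T_def using t by (intro integral_mono it) (auto simp: spP)
  then have Ts: "T \<le> s" using P1 by simp
  have rK: "0 < root n ?V" "root n ?V ^ (n - 1) * root n ?V = ?V" "root n ?V ^ (n - 1) > 0"
    using Kpos n power_minus_mult[OF n, of "root n ?V"] by simp_all
  have "T = (\<integral>u. ?h u / (real n * ?V) * t u \<partial>?S)"
    unfolding T_def n_def by (rule integral_normalized_cone_measure[OF mt])
  also have "\<dots> = (\<integral>u. support_function L u / (real n * ?V) \<partial>?S)"
    using hpos by (intro Bochner_Integration.integral_cong refl) (auto simp: spS t_def less_imp_neq[symmetric])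
  also have "\<dots> = (\<integral>u. support_function L u \<partial>?S) / (real n * ?V)" by simp
  finally have T: "T = (\<integral>u. support_function L u \<partial>?S) / (real n * ?V)" .
  \<comment> \<open>Expanding the fraction by \<open>n\<close> times the \<open>(n - 1)\<close>-st
    power of the root of \<open>V(K)\<close> produces the left side of Minkowski's inequality over
    \<open>n V(K)\<close>.\<close>
  have "m = (real n * root n ?V ^ (n - 1) * root n (measure lebesgue L)) / (real n * (root n ?V ^ (n - 1) * root n ?V))"
    using rK(1,3) n by (simp add: m_def)
  also have "\<dots> \<le> T"
    unfolding T rK(2) using minkowski_first_inequality[OF K(1,2) bd(3) L(1-3)] Kpos n
    by (intro divide_right_mono) (auto simp: n_def)
  finally have mT: "m \<le> T" .
  have m1: "m < 1" using mT Ts s by linarith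
  \<comment> \<open>The height of the tangent line above the logarithm. With
    \<open>x = (1 - t) / (1 - m)\<close> it is \<open>x - 1 - ln x\<close>, which is nonnegative and
    zero only at \<open>x = 1\<close>.\<close>
  define g where "g u = ln (1 - m) + (m - t u) / (1 - m) - f u" for u
  have gdef: "g u = (1 - t u) / (1 - m) - 1 - ln ((1 - t u) / (1 - m))" if "u \<in> sphere 0 1" for u
  proof -
    have "(1 - t u) / (1 - m) - 1 = (m - t u) / (1 - m)" using m1 by (simp add: field_simps)
    moreover have "ln ((1 - t u) / (1 - m)) = ln (1 - t u) - ln (1 - m)"
    proof -
      have "0 < 1 - t u" "0 < 1 - m" using m1 t[OF that] s by auto
      then show ?thesis by (simp add: ln_div)
    qed
    ultimately show ?thesis by (simp add: g_def f_def)
  qed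
  have gpos: "0 \<le> g u" if "u \<in> sphere 0 1" for u
    using gdef[OF that] ln_le_minus_one[of "(1 - t u) / (1 - m)"] t[OF that] s m1 by simp
  have ig: "integrable ?P g" unfolding g_def using it if' by simp
  have Ig: "(\<integral>u. g u \<partial>?P) = ln (1 - m) + (m - T) / (1 - m) - I"
    unfolding g_def I T_def using it if' P1 by simp
  \<comment> \<open>The gap \<open>ln (1 - m) - I\<close> is the sum of two nonnegative parts, the
    integral of \<open>g\<close> and \<open>(T - m) / (1 - m)\<close>; equality makes both
    vanish.\<close>
  have Tm: "(m - T) / (1 - m) \<le> 0" using mT m1 by (simp add: divide_nonpos_pos)
  have "0 \<le> (\<integral>u. g u \<partial>?P)" using gpos by (intro integral_nonneg_AE AE_I2) (auto simp: spP)
  then show "I \<le> ln (1 - m)" using Ig Tm by linarith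
  assume "I = ln (1 - m)"
  then have "(\<integral>u. g u \<partial>?P) = 0" using Ig Tm \<open>0 \<le> (\<integral>u. g u \<partial>?P)\<close> by linarith
  then have "AE u in ?P. g u = 0"
    using gpos by (subst integral_nonneg_eq_0_iff_AE[OF ig, symmetric]) (auto simp: spP)
  then have "AE u in ?P. t u = m"
  proof (rule AE_mp, intro AE_I2 impI)
    fix u assume u: "u \<in> space ?P" "g u = 0"
    then have "ln ((1 - t u) / (1 - m)) = (1 - t u) / (1 - m) - 1" using gdef[of u] by (simp add: spP)
    then have "(1 - t u) / (1 - m) = 1"
      using u t[of u] s m1 by (intro ln_eq_minus_one) (auto simp: spP)
    then show "t u = m" using m1 by simp
  qed
  then show "AE u in ?S. support_function L u / ?h u = m"
    using AE_normalized_cone_measure[OF mt, of m] by (simp only: t_def)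
qed

section \<open>The equality cases\<close>

lemma log_minkowski_inequality_eq_imp:
  defines "n \<equiv> DIM('a)"
  assumes eq: "(\<integral>u. ln ((support_function K u - support_function L u) / support_function K u) \<partial>normalized_cone_measure K)
    = ln (1 - root n (measure lebesgue L) / root n (measure lebesgue K))"
  shows "dilatates K L \<or> L = {0}"
proof -
  let ?S = "surface_area_measure K"
  define m where "m = root n (measure lebesgue L) / root n (measure lebesgue K)"
  have bd: "bounded K" "K \<noteq> {}" "interior K \<noteq> {}" "bounded L" "0 \<in> K"
    using K L compact_imp_bounded interior_subset by auto
  have n: "0 < n" by (simp add: n_def)
  have Kpos: "0 < measure lebesgue K" using K bd by (intro measure_convex_interior_pos)
  have m0: "0 \<le> m" using Kpos by (simp add: m_def n)
  have AE: "AE u in ?S. support_function L u / support_function K u = m"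
    using log_minkowski_inequality(2) eq unfolding m_def n_def by blast
  have sub: "(\<lambda>x. r *\<^sub>R x) ` L \<subseteq> K" if r: "0 \<le> r" "r * m \<le> 1" for r
  proof (rule scaled_subset_if_AE_support_function_le[OF K(1,2) bd(3,5) L(1,2) r(1)])
    show "AE u in ?S. r * support_function L u \<le> support_function K u"
    proof (rule AE_mp[OF AE], intro AE_I2 impI)
      fix u assume u: "u \<in> space ?S" "support_function L u / support_function K u = m"
      have h: "0 < support_function K u"
        using u by (intro support_function_pos) (auto simp: space_surface_area_measure[OF K(1,2) bd(2)])
      then have "r * support_function L u = (r * m) * support_function K u"
        using u(2) by (auto simp: field_simps)
      also have "\<dots> \<le> 1 * support_function K u" using r h by (intro mult_right_mono) auto
      finally show "r * support_function L u \<le> support_function K u" by simp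
    qed
  qed
  show ?thesis
  proof (cases "m = 0")
    case True
    obtain B where B: "\<And>x. x \<in> K \<Longrightarrow> norm x \<le> B" using bd(1) bounded_iff by metis
    have "x = 0" if "x \<in> L" for x
    proof (rule ccontr)
      assume "x \<noteq> 0"
      \<comment> \<open>For \<open>m = 0\<close> every factor \<open>r \<ge> 0\<close> is
        admissible; this one would move \<open>x\<close> to norm \<open>\<bar>B\<bar> + 1\<close>,
        outside \<open>K\<close>.\<close>
      have "norm (((\<bar>B\<bar> + 1) / norm x) *\<^sub>R x) \<le> B"
        using sub[of "(\<bar>B\<bar> + 1) / norm x"] that True by (intro B) auto
      then show False using \<open>x \<noteq> 0\<close> by simp
    qed
    then show ?thesis using L(3) by auto
  next
    case False
    then have m: "0 < m" using m0 by simp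
    \<comment> \<open>The largest admissible factor \<open>r = 1 / m\<close> gives one inclusion;
      the other follows from equality of the volumes.\<close>
    have LK: "L \<subseteq> (\<lambda>x. m *\<^sub>R x) ` K"
    proof
      fix x assume "x \<in> L"
      then have "(1 / m) *\<^sub>R x \<in> K" using sub[of "1 / m"] m by auto
      then show "x \<in> (\<lambda>x. m *\<^sub>R x) ` K" using m by (intro image_eqI[of _ _ "(1 / m) *\<^sub>R x"]) auto
    qed
    have "measure lebesgue ((\<lambda>x. m *\<^sub>R x) ` K) = m ^ n * measure lebesgue K"
      using measure_lebesgue_affine[of m 0 K] m by (simp add: n_def)
    also have "\<dots> = measure lebesgue L"
      using Kpos n by (simp add: m_def power_divide)
    finally have mm: "measure lebesgue ((\<lambda>x. m *\<^sub>R x) ` K) = measure lebesgue L" .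
    have "(\<lambda>x. m *\<^sub>R x) ` K \<subseteq> L"
    proof (rule subset_if_measure_le[OF compact_imp_closed[OF L(1)] LK])
      show "interior ((\<lambda>x. m *\<^sub>R x) ` K) \<noteq> {}"
        using bd(3) m
        by (subst interior_injective_linear_image) (auto simp: inj_on_def intro: linear_scaleR)
    qed (use bd K m mm in \<open>auto intro: bounded_scaling convex_scaling\<close>)
    then show ?thesis using LK m unfolding dilatates_def by blast
  qed
qed

lemma log_minkowski_inequality_eq_if:
  defines "n \<equiv> DIM('a)"
  assumes "dilatates K L \<or> L = {0}"
  shows "(\<integral>u. ln ((support_function K u - support_function L u) / support_function K u) \<partial>normalized_cone_measure K)
    = ln (1 - root n (measure lebesgue L) / root n (measure lebesgue K))"
proof -
  let ?P = "normalized_cone_measure K"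
  have bd: "bounded K" "K \<noteq> {}" "interior K \<noteq> {}"
    using K compact_imp_bounded interior_subset by auto
  have n: "0 < n" by (simp add: n_def)
  have Kpos: "0 < measure lebesgue K" using K bd by (intro measure_convex_interior_pos)
  \<comment> \<open>Both cases take the form \<open>L = t K\<close> with \<open>t \<ge> 0\<close>;
    the value \<open>t = 0\<close> gives \<open>{0}\<close>.\<close>
  obtain t where t: "0 \<le> t" "L = (\<lambda>x. t *\<^sub>R x) ` K"
  proof -
    have "{0} = (\<lambda>x. 0 *\<^sub>R x) ` K" using bd(2) by auto
    then show thesis using assms that unfolding dilatates_def by (metis less_imp_le order_refl)
  qed
  have "measure lebesgue L = t ^ n * measure lebesgue K"
    using measure_lebesgue_affine[of t 0 K] t by (simp add: n_def)
  then have rt: "root n (measure lebesgue L) / root n (measure lebesgue K) = t"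
    using Kpos t(1) n by (simp add: real_root_mult real_root_power_cancel)
  have hL: "support_function L u = t * support_function K u" for u
  proof (rule antisym)
    show "support_function L u \<le> t * support_function K u"
      using t bd(2)
      by (intro support_function_le) (auto intro!: mult_left_mono support_function_ge bd(1))
    have "compact ((\<bullet>) u ` K)" using K(1) by (intro compact_continuous_image continuous_intros)
    then have "\<exists>m\<in>(\<bullet>) u ` K. \<forall>t\<in>(\<bullet>) u ` K. t \<le> m"
      using bd(2) by (intro compact_attains_sup) auto
    then obtain y where y: "y \<in> K" "\<And>z. z \<in> K \<Longrightarrow> u \<bullet> z \<le> u \<bullet> y" by auto
    have "t * support_function K u \<le> t * (u \<bullet> y)"
      using y t bd(2) by (intro mult_left_mono support_function_le) auto
    also have "\<dots> = u \<bullet> (t *\<^sub>R y)" by simp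
    also have "\<dots> \<le> support_function L u"
      using L(1) t(2) y(1) compact_imp_bounded by (intro support_function_ge) auto
    finally show "t * support_function K u \<le> support_function L u" .
  qed
  have spP: "space ?P = sphere 0 1"
    by (simp add: normalized_cone_measure_def space_surface_area_measure[OF K(1,2) bd(2)])
  have "(\<integral>u. ln ((support_function K u - support_function L u) / support_function K u) \<partial>?P) = (\<integral>u. ln (1 - t) \<partial>?P)"
  proof (rule Bochner_Integration.integral_cong[OF refl])
    fix u assume "u \<in> space ?P"
    then have "0 < support_function K u" by (intro support_function_pos) (auto simp: spP)
    then show "ln ((support_function K u - support_function L u) / support_function K u) = ln (1 - t)"
      by (simp add: hL diff_divide_distrib)
  qed
  also have "\<dots> = ln (1 - t)"
    using measure_normalized_cone_measure[of "\<lambda>_. 0"] by (simp add: measure_def)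
  finally show ?thesis unfolding rt .
qed

end

theorem theorem10p4:
  fixes K L :: "(real ^ 'n) set"
  assumes "CARD('n) \<ge> 2"
    and "compact K" and "convex K" and "compact L" and "convex L"
    and "0 \<in> interior K" and "0 \<in> L" and "L \<subseteq> interior K"
  shows "ln ((root CARD('n) (measure lebesgue K) - root CARD('n) (measure lebesgue L))
              / root CARD('n) (measure lebesgue K))
           \<ge> (\<integral>u. ln ((support_function K u - support_function L u) / support_function K u)
                \<partial>(normalized_cone_measure K))
       \<and> (ln ((root CARD('n) (measure lebesgue K) - root CARD('n) (measure lebesgue L))
              / root CARD('n) (measure lebesgue K))
           = (\<integral>u. ln ((support_function K u - support_function L u) / support_function K u)
                \<partial>(normalized_cone_measure K))
         \<longleftrightarrow> dilatates K L \<or> L = {0})"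
proof -
  note KL = assms(2,3,6,4,5,7,8)
  have "0 < measure lebesgue K"
    using assms compact_imp_bounded by (intro measure_convex_interior_pos) auto
  then have *: "(root CARD('n) (measure lebesgue K) - root CARD('n) (measure lebesgue L)) / root CARD('n) (measure lebesgue K)
      = 1 - root CARD('n) (measure lebesgue L) / root CARD('n) (measure lebesgue K)"
    by (simp add: diff_divide_distrib)
  show ?thesis
    unfolding *
    using log_minkowski_inequality(1)[OF KL] log_minkowski_inequality_eq_imp[OF KL]
      log_minkowski_inequality_eq_if[OF KL]
    by auto
qed

end
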